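(* Let $\Bbbk$ be a field of characteristic zero and let $n\ge 1$ be an integer. Then the artinian algebra $A(T_{5,n})$ has the weak Lefschetz property if and only if $n\in\{1,2,3,5,6,9\}$.
   Context: For integers $m\ge 3$, $n\ge 1$, the tadpole graph $T_{m,n}$ is the simple graph with vertex set $\{x_1,\dots,x_m,y_1,\dots,y_n\}$ and edges $\{x_i,x_{i+1}\}$ for $1\le i\le m-1$, $\{x_m,x_1\}$ (so the $x_i$ form an $m$-cycle), $\{y_j,y_{j+1}\}$ for $1\le j\le n-1$ (so the $y_j$ form a path), and the bridge $\{x_m,y_1\}$. For a simple graph $G$ on vertices $1,\dots,N$, let $R=\Bbbk[x_1,\dots,x_N]$ be the standard graded polynomial ring, $I(G)=(x_ix_j : \{i,j\}\text{ an edge of }G)$ its edge ideal, and $A(G)=R/\big((x_1^2,\dots,x_N^2)+I(G)\big)$, a standard graded artinian algebra $A=\bigoplus_{j=0}^s [A]_j$. Such an $A$ has the weak Lefschetz property (WLP) if there is a linear form $\ell\in[A]_1$ such that multiplication $\times\ell:[A]_j\to[A]_{j+1}$ is injective or surjective for every $j=0,\dots,s-1$. *)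

theory Defs
  imports "HOL-Library.Poly_Mapping"
begin

text \<open>Polynomials in countably many variables over 'k: a polynomial maps monomials
(exponent vectors nat =>0 nat) to coefficients.  The ring R = k[x_1,...,x_N] is the set
of polynomials whose monomials only involve the variables 1..N.\<close>

type_synonym 'k mpoly = "(nat \<Rightarrow>\<^sub>0 nat) \<Rightarrow>\<^sub>0 'k"

definition Var :: "nat \<Rightarrow> 'k::comm_ring_1 mpoly" where
  "Var i = Poly_Mapping.single (Poly_Mapping.single i 1) 1"

definition mdeg :: "(nat \<Rightarrow>\<^sub>0 nat) \<Rightarrow> nat" where
  "mdeg m = (\<Sum>i\<in>Poly_Mapping.keys m. Poly_Mapping.lookup m i)"

definition poly_ring :: "nat \<Rightarrow> 'k::comm_ring_1 mpoly set" where
  "poly_ring N = {p. \<forall>m\<in>Poly_Mapping.keys p. Poly_Mapping.keys m \<subseteq> {1..N}}"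

definition homog :: "nat \<Rightarrow> nat \<Rightarrow> 'k::comm_ring_1 mpoly set" where
  "homog N j = {p \<in> poly_ring N. \<forall>m\<in>Poly_Mapping.keys p. mdeg m = j}"

definition ideal_gen :: "nat \<Rightarrow> 'k::comm_ring_1 mpoly set \<Rightarrow> 'k mpoly set" where
  "ideal_gen N S = {p. \<exists>F c. finite F \<and> F \<subseteq> S \<and> (\<forall>g\<in>F. c g \<in> poly_ring N)
                       \<and> p = (\<Sum>g\<in>F. c g * g)}"

text \<open>A simple graph on vertices 1..N is given by a set E of 2-element subsets of {1..N}.
The ideal (x_1^2,...,x_N^2) + I(G).\<close>
definition artin_ideal :: "'k::comm_ring_1 itself \<Rightarrow> nat \<Rightarrow> nat set set \<Rightarrow> 'k mpoly set" where
  "artin_ideal _ N E = ideal_gen N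
     ({Var i ^ 2 | i. i \<in> {1..N}} \<union> {Var i * Var j | i j. {i, j} \<in> E})"

text \<open>[A]_j is nonzero iff some element of [R]_j is not in the ideal.
The socle degree s is the largest such j.\<close>
definition top_degree :: "'k::comm_ring_1 itself \<Rightarrow> nat \<Rightarrow> nat set set \<Rightarrow> nat" where
  "top_degree K N E = (GREATEST j. \<exists>f\<in>(homog N j :: 'k mpoly set). f \<notin> artin_ideal K N E)"

definition mult_inj :: "'k::comm_ring_1 itself \<Rightarrow> nat \<Rightarrow> nat set set \<Rightarrow> 'k mpoly \<Rightarrow> nat \<Rightarrow> bool" where
  "mult_inj K N E l j = (\<forall>f\<in>homog N j. l * f \<in> artin_ideal K N E \<longrightarrow> f \<in> artin_ideal K N E)"

definition mult_surj :: "'k::comm_ring_1 itself \<Rightarrow> nat \<Rightarrow> nat set set \<Rightarrow> 'k mpoly \<Rightarrow> nat \<Rightarrow> bool" where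
  "mult_surj K N E l j = (\<forall>g\<in>homog N (Suc j). \<exists>f\<in>homog N j. g - l * f \<in> artin_ideal K N E)"

definition has_WLP :: "'k::field itself \<Rightarrow> nat \<Rightarrow> nat set set \<Rightarrow> bool" where
  "has_WLP K N E = (\<exists>l\<in>(homog N 1 :: 'k mpoly set).
      \<forall>j < top_degree K N E. mult_inj K N E l j \<or> mult_surj K N E l j)"

text \<open>Tadpole graph T_{m,n}: x_i is vertex i (1<=i<=m), y_j is vertex m+j (1<=j<=n).\<close>
definition tadpole_edges :: "nat \<Rightarrow> nat \<Rightarrow> nat set set" where
  "tadpole_edges m n =
     {{i, i + 1} | i. 1 \<le> i \<and> i \<le> m - 1} \<union> {{m, 1}}
     \<union> {{m + j, m + j + 1} | j. 1 \<le> j \<and> j \<le> n - 1} \<union> {{m, m + 1}}"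

end

theory Submission
  imports Defs "HOL-Computational_Algebra.Polynomial"
begin

text \<open>
  A polynomial lies in the defining ideal iff its coefficients at the squarefree monomials of
  independent sets vanish, so everything is about functions on independent sets.

  Let \<open>r = (n + 2) div 3\<close>.  If \<open>n + 4 \<le> 4 * r\<close>, which fails exactly for
  \<open>n \<in> {1, 2, 3, 5, 6, 9}\<close>, the vertices split into \<open>{1..2 * r + 1}\<close> and a path, and neither
  side contains more than \<open>r\<close> independent vertices.  For a linear form \<open>l = e + L\<close> split
  accordingly, \<open>e ^ (r + 1)\<close> and \<open>L ^ (r + 1)\<close> vanish, so \<open>l\<close> kills
  \<open>\<Sum>i\<le>r. e ^ i * (- L) ^ (r - i)\<close> and injectivity fails in degree \<open>r\<close>.  Surjectivity fails in
  the same degree because of the induced matching formed by the \<open>r + 1\<close> edges \<open>{3 * i - 1, 3 * i}\<close>.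

  For the six remaining \<open>n\<close> the sum of all variables works: deleting vertices one by one reduces
  the rank conditions to edgeless graphs, that is, to the Boolean lattice, where they follow from
  the commutation relation between the up and down operators, and to one pentagon.\<close>

section \<open>Monomials and forms\<close>

lemma poly_mapping_sum_single:
  "p = (\<Sum>m\<in>Poly_Mapping.keys p. Poly_Mapping.single m (Poly_Mapping.lookup p m))"
proof (rule poly_mapping_eqI)
  fix k
  show "Poly_Mapping.lookup p k = Poly_Mapping.lookup (\<Sum>m\<in>Poly_Mapping.keys p.
      Poly_Mapping.single m (Poly_Mapping.lookup p m)) k"
    by (simp add: lookup_sum lookup_single when_def sum.delta in_keys_iff)
qed

lemma lookup_single_mult_add:
  fixes f :: "'k::comm_ring_1 mpoly"
  shows "Poly_Mapping.lookup (Poly_Mapping.single k a * f) (k + t) = a * Poly_Mapping.lookup f t"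
proof -
  have "Poly_Mapping.single k a * f =
      (\<Sum>m\<in>Poly_Mapping.keys f. Poly_Mapping.single (k + m) (a * Poly_Mapping.lookup f m))"
    by (subst poly_mapping_sum_single[of f]) (simp add: sum_distrib_left mult_single)
  then show ?thesis
    by (simp add: lookup_sum lookup_single when_def in_keys_iff)
qed

lemma lookup_single_mult_eq_0:
  fixes f :: "'k::comm_ring_1 mpoly"
  assumes "\<And>t. s \<noteq> k + t"
  shows "Poly_Mapping.lookup (Poly_Mapping.single k a * f) s = 0"
proof -
  have "s \<notin> Poly_Mapping.keys (Poly_Mapping.single k a * f)"
    using keys_mult[of "Poly_Mapping.single k a" f] assms by (auto split: if_splits)
  then show ?thesis by (simp add: in_keys_iff)
qed

section \<open>Squarefree monomials and degrees\<close>

definition mon :: "nat set \<Rightarrow> nat \<Rightarrow>\<^sub>0 nat" where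
  "mon S = (\<Sum>i\<in>S. Poly_Mapping.single i 1)"

lemma lookup_mon: "finite S \<Longrightarrow> Poly_Mapping.lookup (mon S) i = (if i \<in> S then 1 else 0)"
  by (simp add: mon_def lookup_sum lookup_single when_def)

lemma keys_mon: "finite S \<Longrightarrow> Poly_Mapping.keys (mon S) = S"
  by (auto simp: in_keys_iff lookup_mon split: if_splits)

lemma mdeg_mon: "finite S \<Longrightarrow> mdeg (mon S) = card S"
  by (simp add: mdeg_def keys_mon lookup_mon)

lemma mon_inject: "finite S \<Longrightarrow> finite T \<Longrightarrow> mon S = mon T \<longleftrightarrow> S = T"
  by (metis keys_mon)

lemma mon_insert: "finite S \<Longrightarrow> v \<notin> S \<Longrightarrow> mon (insert v S) = Poly_Mapping.single v 1 + mon S"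
  by (simp add: mon_def)

lemma mdeg_eq_sum:
  assumes "finite X" "Poly_Mapping.keys m \<subseteq> X"
  shows "mdeg m = (\<Sum>i\<in>X. Poly_Mapping.lookup m i)"
  unfolding mdeg_def using assms by (intro sum.mono_neutral_left) (auto simp: in_keys_iff)

lemma keys_add_nat: "Poly_Mapping.keys (a + b) = Poly_Mapping.keys a \<union> Poly_Mapping.keys b"
  for a b :: "nat \<Rightarrow>\<^sub>0 nat"
  by (auto simp: in_keys_iff lookup_add)

lemma mdeg_add: "mdeg (a + b) = mdeg a + mdeg b"
proof -
  let ?X = "Poly_Mapping.keys a \<union> Poly_Mapping.keys b"
  have "mdeg (a + b) = (\<Sum>i\<in>?X. Poly_Mapping.lookup (a + b) i)"
    by (intro mdeg_eq_sum) (auto simp: keys_add_nat)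
  also have "\<dots> = (\<Sum>i\<in>?X. Poly_Mapping.lookup a i) + (\<Sum>i\<in>?X. Poly_Mapping.lookup b i)"
    by (simp add: lookup_add sum.distrib)
  also have "\<dots> = mdeg a + mdeg b"
    by (simp add: mdeg_eq_sum[of ?X a] mdeg_eq_sum[of ?X b])
  finally show ?thesis .
qed

text \<open>The variable set is arbitrary because the failure of injectivity treats the two sides of
  a vertex partition as separate sets of variables.\<close>

definition forms :: "nat set \<Rightarrow> nat \<Rightarrow> 'k::comm_ring_1 mpoly set" where
  "forms A d = {p. \<forall>m\<in>Poly_Mapping.keys p. Poly_Mapping.keys m \<subseteq> A \<and> mdeg m = d}"

lemma homog_eq_forms: "homog N d = forms {1..N} d"
  by (auto simp: homog_def poly_ring_def forms_def)

lemma forms_subset_poly_ring: "p \<in> forms {1..N} d \<Longrightarrow> p \<in> poly_ring N"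
  by (auto simp: poly_ring_def forms_def)

lemma forms_mono: "p \<in> forms A d \<Longrightarrow> A \<subseteq> B \<Longrightarrow> p \<in> forms B d"
  by (auto simp: forms_def)

lemma zero_in_forms [simp]: "0 \<in> forms A d"
  by (simp add: forms_def)

lemma one_in_forms [simp]: "1 \<in> forms A 0"
  by (simp add: forms_def mdeg_def)

lemma add_in_forms: "p \<in> forms A d \<Longrightarrow> q \<in> forms A d \<Longrightarrow> p + q \<in> forms A d"
  using keys_add[of p q] by (fastforce simp: forms_def)

lemma uminus_in_forms: "p \<in> forms A d \<Longrightarrow> - p \<in> forms A d"
  by (simp add: forms_def in_keys_iff)

lemma sum_in_forms: "(\<And>x. x \<in> X \<Longrightarrow> h x \<in> forms A d) \<Longrightarrow> sum h X \<in> forms A d"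
  by (induction X rule: infinite_finite_induct) (auto intro: add_in_forms)

lemma mult_in_forms: "p \<in> forms A d \<Longrightarrow> q \<in> forms A d' \<Longrightarrow> p * q \<in> forms A (d + d')"
  using keys_mult[of p q] by (fastforce simp: forms_def keys_add_nat mdeg_add)

lemma single_mon_in_forms: "finite S \<Longrightarrow> S \<subseteq> A \<Longrightarrow> card S = d \<Longrightarrow>
    Poly_Mapping.single (mon S) a \<in> forms A d"
  by (simp add: forms_def keys_mon mdeg_mon)

lemma mdeg_single [simp]: "mdeg (Poly_Mapping.single i c) = c"
  by (simp add: mdeg_def lookup_single)

lemma Var_in_forms: "i \<in> A \<Longrightarrow> Var i \<in> forms A 1"
  by (simp add: forms_def Var_def)

lemma zero_in_poly_ring [simp]: "0 \<in> poly_ring N"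
  by (simp add: poly_ring_def)

lemma add_in_poly_ring: "p \<in> poly_ring N \<Longrightarrow> q \<in> poly_ring N \<Longrightarrow> p + q \<in> poly_ring N"
  using keys_add[of p q] by (fastforce simp: poly_ring_def)

lemma sum_in_poly_ring: "(\<And>x. x \<in> X \<Longrightarrow> h x \<in> poly_ring N) \<Longrightarrow> sum h X \<in> poly_ring N"
  by (induction X rule: infinite_finite_induct) (auto intro: add_in_poly_ring)

lemma mult_in_poly_ring: "p \<in> poly_ring N \<Longrightarrow> q \<in> poly_ring N \<Longrightarrow> p * q \<in> poly_ring N"
  using keys_mult[of p q] by (fastforce simp: poly_ring_def keys_add_nat)

lemma linear_form_eq:
  assumes "l \<in> forms A 1" "finite A"
  shows "l = (\<Sum>i\<in>A. Poly_Mapping.single (Poly_Mapping.single i 1)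
    (Poly_Mapping.lookup l (Poly_Mapping.single i 1)))"
proof -
  let ?x = "\<lambda>i. Poly_Mapping.single i (1::nat)"
  have inj: "inj_on ?x A"
    by (rule inj_onI) (metis keys_single one_neq_zero singleton_inject)
  have "m \<in> ?x ` A" if m: "m \<in> Poly_Mapping.keys l" for m
  proof -
    have sub: "Poly_Mapping.keys m \<subseteq> A" and deg: "mdeg m = 1"
      using assms m by (auto simp: forms_def)
    have "\<exists>i\<in>Poly_Mapping.keys m. Poly_Mapping.lookup m i = 1 \<and>
        (\<forall>j\<in>Poly_Mapping.keys m. i \<noteq> j \<longrightarrow> Poly_Mapping.lookup m j = 0)"
      using deg by (simp add: mdeg_def sum_eq_Suc0_iff)
    then obtain i where i: "i \<in> Poly_Mapping.keys m" "Poly_Mapping.lookup m i = 1"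
      "\<And>j. j \<noteq> i \<Longrightarrow> Poly_Mapping.lookup m j = 0"
      by (metis in_keys_iff)
    have "m = ?x i"
      by (rule poly_mapping_eqI) (auto simp: lookup_single when_def i)
    then show ?thesis using i sub by blast
  qed
  then have "l = (\<Sum>m\<in>?x ` A. Poly_Mapping.single m (Poly_Mapping.lookup l m))"
    by (subst poly_mapping_sum_single, intro sum.mono_neutral_left)
      (auto simp: assms(2) in_keys_iff)
  then show ?thesis unfolding sum.reindex[OF inj] o_def .
qed

text \<open>A variable divides \<open>mon T\<close> only if its index lies in \<open>T\<close>, and
  the cofactor is again squarefree. Hence the squarefree coefficients of \<open>l * f\<close> depend
  only on those of \<open>f\<close>, and multiplication can be studied on functions of finite
  sets.\<close>

lemma lookup_linear_mult_mon:
  fixes l f :: "'k::comm_ring_1 mpoly"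
  assumes l: "l \<in> forms A 1" and A: "finite A" and T: "finite T"
  shows "Poly_Mapping.lookup (l * f) (mon T) =
    (\<Sum>v\<in>T. Poly_Mapping.lookup l (Poly_Mapping.single v 1) * Poly_Mapping.lookup f (mon (T - {v})))"
proof -
  let ?a = "\<lambda>v. Poly_Mapping.lookup l (Poly_Mapping.single v (1::nat))"
  have 1: "Poly_Mapping.lookup (Poly_Mapping.single (Poly_Mapping.single v 1) (?a v) * f) (mon T) =
      (if v \<in> T then ?a v * Poly_Mapping.lookup f (mon (T - {v})) else 0)" for v
  proof (cases "v \<in> T")
    case True
    have "mon T = Poly_Mapping.single v 1 + mon (T - {v})"
      using mon_insert[of "T - {v}" v] T True by (simp add: insert_absorb)
    then show ?thesis using True by (simp add: lookup_single_mult_add)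
  next
    case False
    have "mon T \<noteq> Poly_Mapping.single v 1 + t" for t
    proof
      assume "mon T = Poly_Mapping.single v 1 + t"
      then have "Poly_Mapping.lookup (mon T) v = Poly_Mapping.lookup (Poly_Mapping.single v 1 + t) v"
        by simp
      then show False using False T by (simp add: lookup_mon lookup_add)
    qed
    then show ?thesis using False by (simp add: lookup_single_mult_eq_0)
  qed
  have 2: "?a v = 0" if "v \<notin> A" for v
  proof (rule ccontr)
    assume "?a v \<noteq> 0"
    then have "Poly_Mapping.single v 1 \<in> Poly_Mapping.keys l" by (simp add: in_keys_iff)
    with l have "Poly_Mapping.keys (Poly_Mapping.single v (1::nat)) \<subseteq> A"
      unfolding forms_def by blast
    with that show False by simp
  qed
  have "Poly_Mapping.lookup (l * f) (mon T) =
      (\<Sum>v\<in>A. if v \<in> T then ?a v * Poly_Mapping.lookup f (mon (T - {v})) else 0)"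
    by (subst linear_form_eq[OF l A])
      (simp add: sum_distrib_right lookup_sum 1 del: One_nat_def)
  also have "\<dots> = (\<Sum>v\<in>A \<inter> T. ?a v * Poly_Mapping.lookup f (mon (T - {v})))"
    by (rule sum.inter_restrict[OF A, symmetric])
  also have "\<dots> = (\<Sum>v\<in>T. ?a v * Poly_Mapping.lookup f (mon (T - {v})))"
  proof (intro sum.mono_neutral_left ballI)
    fix v assume "v \<in> T - A \<inter> T"
    then have "v \<notin> A" by blast
    from 2[OF this] show "?a v * Poly_Mapping.lookup f (mon (T - {v})) = 0" by simp
  qed (use T in auto)
  finally show ?thesis .
qed

section \<open>The ideal of a graph\<close>

definition indep :: "nat set set \<Rightarrow> nat set \<Rightarrow> bool" where
  "indep E S \<longleftrightarrow> (\<forall>u\<in>S. \<forall>v\<in>S. {u, v} \<notin> E)"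

lemma indep_mono: "indep E S \<Longrightarrow> T \<subseteq> S \<Longrightarrow> indep E T"
  by (auto simp: indep_def)

definition simple_graph :: "nat \<Rightarrow> nat set set \<Rightarrow> bool" where
  "simple_graph N E \<longleftrightarrow> (\<forall>u v. {u, v} \<in> E \<longrightarrow> u \<noteq> v \<and> u \<in> {1..N} \<and> v \<in> {1..N})"

abbreviation gens :: "nat \<Rightarrow> nat set set \<Rightarrow> 'k::comm_ring_1 mpoly set" where
  "gens N E \<equiv> {Var i ^ 2 | i. i \<in> {1..N}} \<union> {Var i * Var j | i j. {i, j} \<in> E}"

lemma Var_mult_Var:
  "Var i * Var j = Poly_Mapping.single (Poly_Mapping.single i 1 + Poly_Mapping.single j 1) 1"
  by (simp add: Var_def mult_single)

lemma zero_in_ideal_gen: "0 \<in> ideal_gen N G"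
  unfolding ideal_gen_def by (auto intro!: exI[of _ "{}"])

lemma add_in_ideal_gen:
  assumes "p \<in> ideal_gen N G" "q \<in> ideal_gen N G"
  shows "p + q \<in> ideal_gen N G"
proof -
  obtain F c where F: "finite F" "F \<subseteq> G" "\<forall>g\<in>F. c g \<in> poly_ring N" "p = (\<Sum>g\<in>F. c g * g)"
    using assms(1) unfolding ideal_gen_def by blast
  obtain F' c' where F': "finite F'" "F' \<subseteq> G" "\<forall>g\<in>F'. c' g \<in> poly_ring N" "q = (\<Sum>g\<in>F'. c' g * g)"
    using assms(2) unfolding ideal_gen_def by blast
  define d where "d g = (if g \<in> F then c g else 0) + (if g \<in> F' then c' g else 0)" for g
  have "p = (\<Sum>g\<in>F \<union> F'. (if g \<in> F then c g else 0) * g)"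
    unfolding F(4) by (intro sum.mono_neutral_cong_left) (auto simp: F F')
  moreover have "q = (\<Sum>g\<in>F \<union> F'. (if g \<in> F' then c' g else 0) * g)"
    unfolding F'(4) by (intro sum.mono_neutral_cong_left) (auto simp: F F')
  ultimately have "p + q = (\<Sum>g\<in>F \<union> F'. d g * g)"
    by (simp add: d_def algebra_simps sum.distrib)
  moreover have "\<forall>g\<in>F \<union> F'. d g \<in> poly_ring N"
    using F(3) F'(3) by (auto simp: d_def intro: add_in_poly_ring)
  ultimately show ?thesis
    unfolding ideal_gen_def using F(1,2) F'(1,2)
    by (intro CollectI exI[of _ "F \<union> F'"] exI[of _ d]) auto
qed

lemma sum_in_ideal_gen: "(\<And>x. x \<in> X \<Longrightarrow> h x \<in> ideal_gen N G) \<Longrightarrow> sum h X \<in> ideal_gen N G"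
  by (induction X rule: infinite_finite_induct) (auto intro: add_in_ideal_gen zero_in_ideal_gen)

lemma mult_gen_in_ideal_gen: "g \<in> G \<Longrightarrow> c \<in> poly_ring N \<Longrightarrow> c * g \<in> ideal_gen N G"
  unfolding ideal_gen_def by (intro CollectI exI[of _ "{g}"] exI[of _ "\<lambda>_. c"]) auto

text \<open>Such a monomial has an exponent at least 2, or it is squarefree with two adjacent
  vertices in its support; either way a generator divides it.\<close>

lemma single_in_artin_ideal:
  fixes a :: "'k::comm_ring_1"
  assumes m: "Poly_Mapping.keys m \<subseteq> {1..N}"
    and dep: "\<not> (\<exists>S. S \<subseteq> {1..N} \<and> indep E S \<and> m = mon S)"
    and E: "simple_graph N E"
  shows "Poly_Mapping.single m a \<in> artin_ideal TYPE('k) N E"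
proof -
  have 1: "Poly_Mapping.single m a \<in> artin_ideal TYPE('k) N E"
    if "m = t + (Poly_Mapping.single i 1 + Poly_Mapping.single j 1)" "(Var i * Var j :: 'k mpoly) \<in> gens N E"
    for t i j
  proof -
    have "Poly_Mapping.single m a = Poly_Mapping.single t a * (Var i * Var j)"
      by (simp add: that(1) Var_mult_Var mult_single)
    moreover have "Poly_Mapping.single t a \<in> poly_ring N"
      using m that(1) by (simp add: poly_ring_def keys_add_nat)
    ultimately show ?thesis
      using mult_gen_in_ideal_gen[OF that(2)] by (simp add: artin_ideal_def)
  qed
  show ?thesis
  proof (cases "\<exists>i. Poly_Mapping.lookup m i \<ge> 2")
    case True
    then obtain i where i: "Poly_Mapping.lookup m i \<ge> 2" by blast
    have "m = (m - Poly_Mapping.single i 2) + (Poly_Mapping.single i 1 + Poly_Mapping.single i 1)"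
      using i by (intro poly_mapping_eqI) (auto simp: lookup_add lookup_minus lookup_single when_def)
    moreover have "i \<in> {1..N}"
      using i m by (metis in_keys_iff not_numeral_le_zero subsetD)
    then have "(Var i * Var i :: 'k mpoly) \<in> gens N E"
      by (auto simp: power2_eq_square)
    ultimately show ?thesis by (rule 1)
  next
    case False
    have m_eq: "m = mon (Poly_Mapping.keys m)"
    proof (rule poly_mapping_eqI)
      fix i
      have "Poly_Mapping.lookup m i < 2" using False by (simp add: not_le)
      then show "Poly_Mapping.lookup m i = Poly_Mapping.lookup (mon (Poly_Mapping.keys m)) i"
        by (auto simp: lookup_mon in_keys_iff)
    qed
    then have "\<not> indep E (Poly_Mapping.keys m)" using dep m by blast
    then obtain i j where ij: "i \<in> Poly_Mapping.keys m" "j \<in> Poly_Mapping.keys m" "{i, j} \<in> E"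
      by (auto simp: indep_def)
    then have "i \<noteq> j" using E by (auto simp: simple_graph_def)
    then have "m = mon (Poly_Mapping.keys m - {i, j}) + (Poly_Mapping.single i 1 + Poly_Mapping.single j 1)"
      using ij by (subst m_eq, intro poly_mapping_eqI)
        (auto simp: lookup_add lookup_mon lookup_single when_def)
    moreover have "(Var i * Var j :: 'k mpoly) \<in> gens N E" using ij by auto
    ultimately show ?thesis by (rule 1)
  qed
qed

text \<open>The ideal is monomial. Every generator contains a square or an edge, so its multiples
  have no coefficient at an independent set; all other monomials lie in the ideal by
  \<open>single_in_artin_ideal\<close>.\<close>

lemma artin_ideal_iff:
  fixes p :: "'k::comm_ring_1 mpoly"
  assumes E: "simple_graph N E"
  shows "p \<in> artin_ideal TYPE('k) N E \<longleftrightarrow>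
    p \<in> poly_ring N \<and> (\<forall>S. S \<subseteq> {1..N} \<longrightarrow> indep E S \<longrightarrow> Poly_Mapping.lookup p (mon S) = 0)"
    (is "?L \<longleftrightarrow> ?R")
proof
  assume ?L
  then obtain F c where F: "finite F" "F \<subseteq> gens N E" "\<forall>g\<in>F. c g \<in> poly_ring N"
    "p = (\<Sum>g\<in>F. c g * g)"
    unfolding artin_ideal_def ideal_gen_def by blast
  have gen: "\<exists>i j. g = Poly_Mapping.single (Poly_Mapping.single i 1 + Poly_Mapping.single j 1) 1 \<and>
      i \<in> {1..N} \<and> j \<in> {1..N} \<and> (i = j \<or> {i, j} \<in> E)" if "g \<in> F" for g
  proof -
    have "g \<in> gens N E" using that F(2) by blast
    then consider i where "g = Var i * Var i" "i \<in> {1..N}" | i j where "g = Var i * Var j" "{i, j} \<in> E"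
      by (auto simp: power2_eq_square)
    then show ?thesis
    proof cases
      case (1 i)
      then show ?thesis unfolding Var_mult_Var by blast
    next
      case (2 i j)
      then show ?thesis using E unfolding Var_mult_Var simple_graph_def by blast
    qed
  qed
  have "g \<in> poly_ring N" if "g \<in> F" for g
    using gen[OF that] by (auto simp: poly_ring_def keys_add_nat)
  then have "p \<in> poly_ring N"
    unfolding F(4) using F(3) by (intro sum_in_poly_ring mult_in_poly_ring) auto
  moreover have "Poly_Mapping.lookup p (mon S) = 0" if S: "S \<subseteq> {1..N}" "indep E S" for S
  proof -
    have fin: "finite S" using S(1) finite_subset by blast
    have "Poly_Mapping.lookup (c g * g) (mon S) = 0" if gF: "g \<in> F" for g
    proof -
      obtain i j where g: "g = Poly_Mapping.single (Poly_Mapping.single i 1 + Poly_Mapping.single j 1) 1"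
        and ij: "i = j \<or> {i, j} \<in> E" using gen[OF gF] by metis
      have "mon S \<noteq> Poly_Mapping.single i 1 + Poly_Mapping.single j 1 + t" for t
      proof
        assume eq: "mon S = Poly_Mapping.single i 1 + Poly_Mapping.single j 1 + t"
        have "Poly_Mapping.lookup (mon S) i \<ge> (if i = j then 2 else 1)"
          "Poly_Mapping.lookup (mon S) j \<ge> 1"
          unfolding eq by (auto simp: lookup_add lookup_single)
        then have "i \<in> S" "j \<in> S" "i \<noteq> j"
          using fin by (auto simp: lookup_mon split: if_splits)
        then show False using ij S(2) by (auto simp: indep_def)
      qed
      then show ?thesis
        unfolding g by (subst mult.commute) (rule lookup_single_mult_eq_0)
    qed
    then show ?thesis by (simp add: F(4) lookup_sum)
  qed
  ultimately show ?R by blast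
next
  assume R: ?R
  have "Poly_Mapping.single m (Poly_Mapping.lookup p m) \<in> artin_ideal TYPE('k) N E"
    if "m \<in> Poly_Mapping.keys p" for m
  proof (rule single_in_artin_ideal[OF _ _ E])
    show "Poly_Mapping.keys m \<subseteq> {1..N}" using R that by (auto simp: poly_ring_def)
    show "\<not> (\<exists>S. S \<subseteq> {1..N} \<and> indep E S \<and> m = mon S)"
      using R that by (auto simp: in_keys_iff)
  qed
  then have "(\<Sum>m\<in>Poly_Mapping.keys p. Poly_Mapping.single m (Poly_Mapping.lookup p m))
      \<in> artin_ideal TYPE('k) N E"
    unfolding artin_ideal_def by (rule sum_in_ideal_gen)
  then show ?L by (simp only: poly_mapping_sum_single[symmetric])
qed

context
  fixes N :: nat and E :: "nat set set"
  assumes E: "simple_graph N E"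
begin

lemma forms_artin_ideal_iff:
  fixes p :: "'k::comm_ring_1 mpoly"
  assumes "p \<in> forms {1..N} d"
  shows "p \<in> artin_ideal TYPE('k) N E \<longleftrightarrow>
    (\<forall>S. S \<subseteq> {1..N} \<longrightarrow> indep E S \<longrightarrow> card S = d \<longrightarrow> Poly_Mapping.lookup p (mon S) = 0)"
proof -
  have "card S = d" if "S \<subseteq> {1..N}" "Poly_Mapping.lookup p (mon S) \<noteq> 0" for S
  proof -
    have "finite S" using that(1) finite_subset by blast
    moreover have "mdeg (mon S) = d" using assms that(2) by (simp add: forms_def in_keys_iff)
    ultimately show ?thesis by (simp add: mdeg_mon)
  qed
  then show ?thesis
    using assms forms_subset_poly_ring by (auto simp: artin_ideal_iff[OF E])
qed

text \<open>Makes powers of linear forms in the variables of \<open>A\<close> vanish in the quotient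
  once the exponent exceeds the independence number of \<open>A\<close>.\<close>

lemma forms_subset_artin_ideal:
  fixes p :: "'k::comm_ring_1 mpoly"
  assumes p: "p \<in> forms A d" and A: "A \<subseteq> {1..N}"
    and small: "\<And>S. S \<subseteq> A \<Longrightarrow> indep E S \<Longrightarrow> card S < d"
  shows "p \<in> artin_ideal TYPE('k) N E"
proof -
  have "Poly_Mapping.lookup p (mon S) = 0" if S: "S \<subseteq> {1..N}" "indep E S" "card S = d" for S
  proof (rule ccontr)
    assume "Poly_Mapping.lookup p (mon S) \<noteq> 0"
    moreover have "finite S" using S(1) finite_subset by blast
    ultimately have m: "mon S \<in> Poly_Mapping.keys p" "Poly_Mapping.keys (mon S) = S"
      by (simp_all add: in_keys_iff keys_mon)
    from m(1) p have "Poly_Mapping.keys (mon S) \<subseteq> A" unfolding forms_def by blast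
    then have "S \<subseteq> A" using m(2) by simp
    then show False using small[OF _ S(2)] S(3) by simp
  qed
  then show ?thesis
    using forms_artin_ideal_iff[OF forms_mono[OF p A]] by blast
qed

lemma artin_ideal_add:
  fixes p q :: "'k::comm_ring_1 mpoly"
  assumes "p \<in> artin_ideal TYPE('k) N E" "q \<in> artin_ideal TYPE('k) N E"
  shows "p + q \<in> artin_ideal TYPE('k) N E"
  using assms by (simp add: artin_ideal_def add_in_ideal_gen)

lemma artin_ideal_uminus:
  fixes p q :: "'k::comm_ring_1 mpoly"
  assumes "p \<in> artin_ideal TYPE('k) N E"
  shows "- p \<in> artin_ideal TYPE('k) N E"
  using assms by (simp add: artin_ideal_iff[OF E] poly_ring_def in_keys_iff)

text \<open>Subsets of independent sets are independent, so the coefficient formula for the product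
  meets only vanishing coefficients of \<open>p\<close>.\<close>

lemma artin_ideal_linear_mult:
  fixes p l :: "'k::comm_ring_1 mpoly"
  assumes p: "p \<in> artin_ideal TYPE('k) N E" and l: "l \<in> forms {1..N} 1"
  shows "l * p \<in> artin_ideal TYPE('k) N E"
proof -
  have p': "p \<in> poly_ring N"
    "Poly_Mapping.lookup p (mon S) = 0" if "S \<subseteq> {1..N}" "indep E S" for S
    using p that unfolding artin_ideal_iff[OF E] by blast+
  have "Poly_Mapping.lookup (l * p) (mon S) = 0" if S: "S \<subseteq> {1..N}" "indep E S" for S
  proof -
    have "finite S" using S(1) finite_subset by blast
    moreover have "Poly_Mapping.lookup p (mon (S - {v})) = 0" for v
      using S by (intro p') (auto intro: indep_mono)
    ultimately show ?thesis by (simp add: lookup_linear_mult_mon[OF l])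
  qed
  moreover have "l * p \<in> poly_ring N"
    using p forms_subset_poly_ring[OF l] mult_in_poly_ring unfolding artin_ideal_iff[OF E] by blast
  ultimately show ?thesis unfolding artin_ideal_iff[OF E] by blast
qed

end

section \<open>Failure of injectivity\<close>

text \<open>The outer polynomial variable is the perturbation parameter \<open>t\<close>, which
  carries no degree.\<close>

definition poly_forms :: "nat set \<Rightarrow> nat \<Rightarrow> 'k::comm_ring_1 mpoly poly set" where
  "poly_forms A d = {P. \<forall>k. coeff P k \<in> forms A d}"

lemma mult_in_poly_forms: "P \<in> poly_forms A d \<Longrightarrow> Q \<in> poly_forms A d' \<Longrightarrow> P * Q \<in> poly_forms A (d + d')"
  by (auto simp: poly_forms_def coeff_mult intro!: sum_in_forms mult_in_forms)

lemma power_in_poly_forms: "P \<in> poly_forms A 1 \<Longrightarrow> P ^ d \<in> poly_forms A d"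
proof (induction d)
  case 0
  then show ?case by (simp add: poly_forms_def coeff_1)
next
  case (Suc d)
  then show ?case using mult_in_poly_forms[of P A 1 "P ^ d" d] by simp
qed

lemma sum_in_poly_forms: "(\<And>x. x \<in> X \<Longrightarrow> h x \<in> poly_forms A d) \<Longrightarrow> sum h X \<in> poly_forms A d"
  by (auto simp: poly_forms_def coeff_sum intro!: sum_in_forms)

lemma poly_forms_mono: "P \<in> poly_forms A d \<Longrightarrow> A \<subseteq> B \<Longrightarrow> P \<in> poly_forms B d"
  by (auto simp: poly_forms_def intro: forms_mono)

lemma linear_in_poly_forms: "a \<in> forms A d \<Longrightarrow> b \<in> forms A d \<Longrightarrow> [:a, b:] \<in> poly_forms A d"
  by (auto simp: poly_forms_def coeff_pCons split: nat.split)

lemma coeff_linear_power_ge: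
  fixes a b :: "'a::comm_ring_1"
  shows "coeff ([:a, b:] ^ n) n = b ^ n \<and> (\<forall>k>n. coeff ([:a, b:] ^ n) k = 0)"
proof (induction n)
  case 0
  then show ?case by (simp add: coeff_1)
next
  case (Suc n)
  then show ?case by (auto simp: coeff_pCons split: nat.split)
qed

lemma lookup_sum_Var:
  assumes "finite S" "v \<in> S"
  shows "Poly_Mapping.lookup (\<Sum>i\<in>S. Var i) (Poly_Mapping.single v 1) = (1::'k::comm_ring_1)"
proof -
  have "Poly_Mapping.single i (1::nat) = Poly_Mapping.single v 1 \<longleftrightarrow> i = v" for i
    by (metis keys_single one_neq_zero singleton_inject)
  then show ?thesis
    using assms by (auto simp: lookup_sum Var_def lookup_single when_def)
qed

text \<open>By induction, each of the \<open>card T\<close> choices of a factor to split off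
  contributes \<open>fact (card T - 1)\<close>. Characteristic zero makes the result
  nonzero.\<close>

lemma lookup_sum_Var_power:
  assumes "finite S" "T \<subseteq> S"
  shows "Poly_Mapping.lookup ((\<Sum>i\<in>S. Var i) ^ card T) (mon T) = (fact (card T) :: 'k::field_char_0)"
  using assms(2)
proof (induction "card T" arbitrary: T)
  case 0
  then have "T = {}" using finite_subset[OF _ assms(1)] by simp
  then show ?case by (simp add: mon_def)
next
  case (Suc d)
  have fin: "finite T" using Suc.prems assms(1) finite_subset by blast
  have l: "(\<Sum>i\<in>S. Var i) \<in> (forms S 1 :: 'k mpoly set)"
    by (intro sum_in_forms Var_in_forms)
  have "Poly_Mapping.lookup ((\<Sum>i\<in>S. Var i) ^ Suc d) (mon T) = (\<Sum>v\<in>T. fact d :: 'k)"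
    unfolding power_Suc lookup_linear_mult_mon[OF l assms(1) fin]
  proof (rule sum.cong[OF refl])
    fix v assume v: "v \<in> T"
    then have d: "d = card (T - {v})" using Suc.hyps(2) fin by simp
    have "Poly_Mapping.lookup ((\<Sum>i\<in>S. Var i) ^ d) (mon (T - {v})) = (fact d :: 'k)"
      using Suc.hyps(1)[OF d] Suc.prems d by auto
    then show "Poly_Mapping.lookup (\<Sum>i\<in>S. Var i) (Poly_Mapping.single v 1) *
        Poly_Mapping.lookup ((\<Sum>i\<in>S. Var i) ^ d) (mon (T - {v})) = (fact d :: 'k)"
      using lookup_sum_Var[OF assms(1), of v, where 'k = 'k] v Suc.prems by auto
  qed
  also have "\<dots> = fact (card T)"
    using Suc.hyps(2) by (simp flip: Suc.hyps(2))
  finally show ?case using Suc.hyps(2) by simp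
qed

text \<open>
  The form \<open>\<Sum>i\<le>r. e ^ i * (- L) ^ (r - i)\<close> killed by \<open>l = e + L\<close> may itself vanish in the
  quotient when some coefficients of \<open>l\<close> are zero.  Therefore \<open>e\<close> is perturbed to \<open>e + t * e1\<close> and the lowest nonvanishing coefficient in \<open>t\<close> is used.\<close>

lemma not_mult_inj_if_split:
  fixes l :: "'k::field_char_0 mpoly"
  assumes E: "simple_graph N E" and l: "l \<in> homog N 1"
    and AB: "A \<union> B = {1..N}" "A \<inter> B = {}"
    and smallA: "\<And>S. S \<subseteq> A \<Longrightarrow> indep E S \<Longrightarrow> card S \<le> r"
    and smallB: "\<And>S. S \<subseteq> B \<Longrightarrow> indep E S \<Longrightarrow> card S \<le> r"
    and S: "S \<subseteq> A" "indep E S" "card S = r"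
  shows "\<not> mult_inj TYPE('k) N E l r"
proof
  assume inj: "mult_inj TYPE('k) N E l r"
  let ?I = "artin_ideal TYPE('k) N E"
  let ?part = "\<lambda>X. \<Sum>i\<in>X. Poly_Mapping.single (Poly_Mapping.single i (1::nat))
    (Poly_Mapping.lookup l (Poly_Mapping.single i 1))"
  define e where "e = ?part A"
  define L where "L = ?part B"
  \<comment> \<open>Direction of the perturbation: \<open>e1 ^ r\<close> has coefficient
    \<open>fact r\<close> at \<open>S\<close>, so it survives in the quotient.\<close>
  define e1 :: "'k mpoly" where "e1 = (\<Sum>i\<in>S. Var i)"
  have sub: "A \<subseteq> {1..N}" "B \<subseteq> {1..N}" using AB by auto
  have fin: "finite A" "finite B" using sub finite_subset by blast+
  have finS: "finite S" using S(1) fin finite_subset by blast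
  have l': "l \<in> forms {1..N} 1" using l by (simp add: homog_eq_forms)
  have "l = ?part {1..N}" using linear_form_eq[OF l'] by blast
  then have l_eq: "l = e + L"
    unfolding e_def L_def by (subst sum.union_disjoint[symmetric]) (use AB fin in auto)
  have part: "?part X \<in> forms X 1" for X
    by (rule sum_in_forms) (simp add: forms_def)
  have e: "e \<in> forms A 1" and L: "L \<in> forms B 1"
    unfolding e_def L_def by (rule part)+
  have e1: "e1 \<in> forms A 1"
    unfolding e1_def by (intro sum_in_forms Var_in_forms) (use S(1) in auto)
  define X where "X = [:e, e1:]"
  define Y where "Y = [:- L, 0:]"
  \<comment> \<open>The cofactor of \<open>X - Y\<close> in \<open>X ^ Suc r - Y ^ Suc r\<close>.
    Both powers exceed the independence number of their side.\<close>
  define P where "P = (\<Sum>i<Suc r. X ^ i * Y ^ (r - i))"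
  have X: "X \<in> poly_forms A 1"
    unfolding X_def by (intro linear_in_poly_forms e e1)
  have Y: "Y \<in> poly_forms B 1"
    unfolding Y_def by (intro linear_in_poly_forms uminus_in_forms L zero_in_forms)
  have P: "P \<in> poly_forms {1..N} r"
  proof -
    have "X ^ i * Y ^ (r - i) \<in> poly_forms {1..N} r" if "i < Suc r" for i
      using mult_in_poly_forms[OF power_in_poly_forms[OF poly_forms_mono[OF X sub(1)], of i]
          power_in_poly_forms[OF poly_forms_mono[OF Y sub(2)], of "r - i"]] that by simp
    then show ?thesis unfolding P_def by (intro sum_in_poly_forms) auto
  qed
  have XY: "(X - Y) * P = X ^ Suc r - Y ^ Suc r"
    unfolding P_def by (rule diff_power_eq_sum[symmetric])
  have diff: "X - Y = [:l, e1:]" by (simp add: X_def Y_def l_eq)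
  have coeff_mem: "coeff ((X - Y) * P) k \<in> ?I" for k
  proof -
    have "coeff (X ^ Suc r) k \<in> ?I"
    proof (rule forms_subset_artin_ideal[OF E _ sub(1)])
      show "coeff (X ^ Suc r) k \<in> forms A (Suc r)"
        using power_in_poly_forms[OF X, of "Suc r"] by (simp add: poly_forms_def)
    qed (use smallA in \<open>auto simp: less_Suc_eq_le\<close>)
    moreover have "coeff (Y ^ Suc r) k \<in> ?I"
    proof (rule forms_subset_artin_ideal[OF E _ sub(2)])
      show "coeff (Y ^ Suc r) k \<in> forms B (Suc r)"
        using power_in_poly_forms[OF Y, of "Suc r"] by (simp add: poly_forms_def)
    qed (use smallB in \<open>auto simp: less_Suc_eq_le\<close>)
    ultimately show ?thesis
      unfolding XY coeff_diff using artin_ideal_add[OF E] artin_ideal_uminus[OF E]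
      by (metis diff_conv_add_uminus)
  qed
  have step: "l * coeff P k + (case k of 0 \<Rightarrow> 0 | Suc k' \<Rightarrow> e1 * coeff P k') \<in> ?I" for k
    using coeff_mem[of k] unfolding diff by (cases k) (simp_all add: coeff_pCons)
  \<comment> \<open>Coefficient \<open>k\<close> of \<open>(l + t * e1) * P\<close> is
    \<open>l * coeff P k\<close> plus a multiple of the previous coefficient, which lies in the
    ideal by induction; injectivity then cancels \<open>l\<close>.\<close>
  have Pk: "coeff P k \<in> ?I" for k
  proof (induction k)
    case 0
    have "l * coeff P 0 \<in> ?I" using step[of 0] by simp
    then show ?case using inj P unfolding mult_inj_def poly_forms_def homog_eq_forms by blast
  next
    case (Suc k)
    have "e1 * coeff P k \<in> ?I"
      using artin_ideal_linear_mult[OF E Suc forms_mono[OF e1 sub(1)]] .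
    moreover have "l * coeff P (Suc k) + e1 * coeff P k \<in> ?I"
      using step[of "Suc k"] by simp
    ultimately have "(l * coeff P (Suc k) + e1 * coeff P k) + - (e1 * coeff P k) \<in> ?I"
      by (rule artin_ideal_add[OF E _ artin_ideal_uminus[OF E], rotated])
    then have "l * coeff P (Suc k) \<in> ?I" by simp
    then show ?case using inj P unfolding mult_inj_def poly_forms_def homog_eq_forms by blast
  qed
  \<comment> \<open>\<open>Y\<close> does not involve \<open>t\<close>, so only the summand
    \<open>i = r\<close> reaches \<open>t ^ r\<close>.\<close>
  have "coeff P r = e1 ^ r"
  proof -
    have "coeff (X ^ i * Y ^ (r - i)) r = 0" if "i < r" for i
    proof -
      have "Y ^ (r - i) = [:(- L) ^ (r - i):]" by (simp add: Y_def poly_const_pow)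
      then show ?thesis using coeff_linear_power_ge[of e e1 i] that by (simp add: X_def)
    qed
    then show ?thesis
      using coeff_linear_power_ge[of e e1 r]
      by (simp add: P_def coeff_sum X_def)
  qed
  then have "e1 ^ r \<in> ?I" using Pk by metis
  then have "Poly_Mapping.lookup (e1 ^ r) (mon S) = 0"
    using S sub unfolding artin_ideal_iff[OF E] by blast
  moreover have "Poly_Mapping.lookup (e1 ^ r) (mon S) = fact r"
    using lookup_sum_Var_power[OF finS subset_refl, where 'k = 'k] S(3) by (simp add: e1_def)
  ultimately show False by simp
qed

section \<open>Deletion of vertices\<close>

text \<open>Multiplication by the sum of all variables, read on squarefree coefficients.\<close>

definition up :: "(nat set \<Rightarrow> 'k::comm_ring_1) \<Rightarrow> nat set \<Rightarrow> 'k" where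
  "up f T = (\<Sum>v\<in>T. f (T - {v}))"

text \<open>Only the values of \<open>f\<close> at independent \<open>j\<close>-subsets of
  \<open>V\<close> enter, because \<open>T - {v}\<close> inherits independence from
  \<open>T\<close>. Induced subgraphs are obtained by shrinking \<open>V\<close> while
  \<open>E\<close> stays fixed.\<close>

definition up_inj :: "'k::comm_ring_1 itself \<Rightarrow> nat set set \<Rightarrow> nat set \<Rightarrow> nat \<Rightarrow> bool" where
  "up_inj _ E V j \<longleftrightarrow> (\<forall>f :: nat set \<Rightarrow> 'k.
     (\<forall>T. T \<subseteq> V \<longrightarrow> indep E T \<longrightarrow> card T = Suc j \<longrightarrow> up f T = 0) \<longrightarrow>
     (\<forall>S. S \<subseteq> V \<longrightarrow> indep E S \<longrightarrow> card S = j \<longrightarrow> f S = 0))"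

text \<open>Indexed by the target degree, whereas \<open>up_inj\<close> is indexed by the source
  degree. It fails for \<open>k = 0\<close>, since \<open>up f {}\<close> is 0.\<close>

definition up_surj :: "'k::comm_ring_1 itself \<Rightarrow> nat set set \<Rightarrow> nat set \<Rightarrow> nat \<Rightarrow> bool" where
  "up_surj _ E V k \<longleftrightarrow> (\<forall>g :: nat set \<Rightarrow> 'k. \<exists>f.
     \<forall>T. T \<subseteq> V \<longrightarrow> indep E T \<longrightarrow> card T = k \<longrightarrow> up f T = g T)"

lemma up_insert:
  assumes "finite T" "v \<notin> T"
  shows "up f (insert v T) = f T + up (\<lambda>S. f (insert v S)) T"
proof -
  have "up f (insert v T) = f T + (\<Sum>u\<in>T. f (insert v T - {u}))"
    using assms by (simp add: up_def)
  also have "(\<Sum>u\<in>T. f (insert v T - {u})) = up (\<lambda>S. f (insert v S)) T"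
    unfolding up_def using assms(2)
    by (intro sum.cong refl arg_cong[of _ _ f]) auto
  finally show ?thesis .
qed

lemma indep_insert_iff:
  assumes "simple_graph N E"
  shows "indep E (insert v S) \<longleftrightarrow> indep E S \<and> (\<forall>u\<in>S. {v, u} \<notin> E)"
proof -
  have "{v, v} \<notin> E" using assms unfolding simple_graph_def by blast
  then show ?thesis by (auto simp: indep_def insert_commute)
qed

text \<open>Deleting a vertex \<open>v\<close> corresponds to the exact sequence
  \<open>0 \<longrightarrow> A(G - N[v])(-1) \<longrightarrow> A(G) \<longrightarrow> A(G - v) \<longrightarrow> 0\<close>.\<close>

lemma up_inj_vertex:
  assumes E: "simple_graph N E" and V: "finite V" and W: "W = {u \<in> V - {v}. {v, u} \<notin> E}"
    and del: "up_inj TYPE('k) E (V - {v}) j"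
    and link: "j = 0 \<or> up_inj TYPE('k::comm_ring_1) E W (j - 1)"
  shows "up_inj TYPE('k) E V j"
  unfolding up_inj_def
proof (intro allI impI)
  fix f :: "nat set \<Rightarrow> 'k" and S
  assume f: "\<forall>T. T \<subseteq> V \<longrightarrow> indep E T \<longrightarrow> card T = Suc j \<longrightarrow> up f T = 0"
    and S: "S \<subseteq> V" "indep E S" "card S = j"
  have f_del: "f S = 0" if "S \<subseteq> V - {v}" "indep E S" "card S = j" for S
    using del f that unfolding up_inj_def by blast
  show "f S = 0"
  proof (cases "v \<in> S")
    case False
    then show ?thesis using f_del S by blast
  next
    case True
    have finS: "finite S" using S(1) V finite_subset by blast
    then have j: "j \<noteq> 0" using True S(3) by (auto simp: card_gt_0_iff)
    let ?h = "\<lambda>S. f (insert v S)"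
    \<comment> \<open>\<open>f\<close> already vanishes on sets avoiding \<open>v\<close>, so
      \<open>up_insert\<close> turns the equation at \<open>insert v T\<close> into one for
      \<open>?h\<close> on the non-neighbours of \<open>v\<close>.\<close>
    have "up ?h T = 0" if T: "T \<subseteq> W" "indep E T" "card T = Suc (j - 1)" for T
    proof -
      have T': "T \<subseteq> V - {v}" "finite T" "v \<notin> T" using T(1) W V by (auto intro: finite_subset)
      have "v \<in> V" using S(1) True by blast
      then have "insert v T \<subseteq> V" "indep E (insert v T)" "card (insert v T) = Suc j"
        using T T' j W by (auto simp: indep_insert_iff[OF E])
      then have "up f (insert v T) = 0" using f by blast
      moreover have "f T = 0" using f_del T T' j by simp
      ultimately show ?thesis using up_insert[OF T'(2,3), of f] by simp
    qed
    moreover have "S - {v} \<subseteq> W" "indep E (S - {v})" "card (S - {v}) = j - 1"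
      using S True finS W by (auto simp: indep_def)
    ultimately have "?h (S - {v}) = 0"
      using link j unfolding up_inj_def by blast
    then show ?thesis using True by (simp add: insert_absorb)
  qed
qed

lemma up_surj_vertex:
  assumes E: "simple_graph N E" and V: "finite V" and W: "W = {u \<in> V - {v}. {v, u} \<notin> E}"
    and del: "up_surj TYPE('k) E (V - {v}) (Suc k)"
    and link: "up_surj TYPE('k::comm_ring_1) E W k"
  shows "up_surj TYPE('k) E V (Suc k)"
  unfolding up_surj_def
proof (intro allI)
  fix g :: "nat set \<Rightarrow> 'k"
  obtain f0 where f0: "\<And>T. T \<subseteq> V - {v} \<Longrightarrow> indep E T \<Longrightarrow> card T = Suc k \<Longrightarrow> up f0 T = g T"
    using del unfolding up_surj_def by blast
  \<comment> \<open>By \<open>up_insert\<close> the equation at \<open>insert v T\<close> also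
    contains \<open>f0 T\<close>; \<open>f1\<close> absorbs it.\<close>
  obtain f1 where f1: "\<And>T. T \<subseteq> W \<Longrightarrow> indep E T \<Longrightarrow> card T = k \<Longrightarrow>
      up f1 T = g (insert v T) - f0 T"
    using link unfolding up_surj_def by (elim allE[of _ "\<lambda>T. g (insert v T) - f0 T"]) blast
  define f where "f S = (if v \<in> S then f1 (S - {v}) else f0 S)" for S
  have "up f T = g T" if T: "T \<subseteq> V" "indep E T" "card T = Suc k" for T
  proof (cases "v \<in> T")
    case False
    then have "up f T = up f0 T"
      unfolding up_def f_def by (intro sum.cong) auto
    then show ?thesis using f0 T False by auto
  next
    case True
    have finT: "finite T" using T(1) V finite_subset by blast
    define T' where "T' = T - {v}"
    have T': "T = insert v T'" "v \<notin> T'" "finite T'" "T' \<subseteq> W" "indep E T'" "card T' = k"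
      using True finT T W by (auto simp: T'_def indep_def)
    have "up (\<lambda>S. f (insert v S)) T' = up f1 T'"
      unfolding up_def f_def using T'(2) by (intro sum.cong refl) (auto intro: arg_cong[of _ _ f1])
    then show ?thesis
      using up_insert[OF T'(3,2), of f] f1[OF T'(4-6)] T'(1,2) by (simp add: f_def)
  qed
  then show "\<exists>f. \<forall>T. T \<subseteq> V \<longrightarrow> indep E T \<longrightarrow> card T = Suc k \<longrightarrow> up f T = g T" by blast
qed

section \<open>The Boolean lattice\<close>

text \<open>The adjoint of \<open>up\<close> on the subsets of \<open>V\<close>; the two operators
  generate the sl_2 action on the Boolean lattice.\<close>

definition down :: "nat set \<Rightarrow> (nat set \<Rightarrow> 'k::comm_ring_1) \<Rightarrow> nat set \<Rightarrow> 'k" where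
  "down V f S = (\<Sum>v\<in>V - S. f (insert v S))"

text \<open>Removing \<open>u\<close> and adding \<open>v\<close> commute when
  \<open>u \<noteq> v\<close>. The two orders differ only in the terms that return to
  \<open>S\<close>, of which there are \<open>card (V - S)\<close> and
  \<open>card S\<close>.\<close>

lemma up_down_commute:
  fixes f :: "nat set \<Rightarrow> 'k::comm_ring_1"
  assumes V: "finite V" and S: "S \<subseteq> V"
  shows "down V (up f) S + of_nat (card S) * f S = up (down V f) S + of_nat (card (V - S)) * f S"
proof -
  have finS: "finite S" using V S finite_subset by blast
  have "down V (up f) S = (\<Sum>v\<in>V - S. f S + (\<Sum>u\<in>S. f (insert v (S - {u}))))"
    unfolding down_def
  proof (intro sum.cong refl)
    fix v assume "v \<in> V - S"
    then show "up f (insert v S) = f S + (\<Sum>u\<in>S. f (insert v (S - {u})))"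
      using up_insert[OF finS, of v f] by (simp add: up_def)
  qed
  also have "\<dots> = of_nat (card (V - S)) * f S + (\<Sum>v\<in>V - S. \<Sum>u\<in>S. f (insert v (S - {u})))"
    by (simp add: sum.distrib)
  finally have 1: "down V (up f) S = \<dots>" .
  have "up (down V f) S = (\<Sum>u\<in>S. f S + (\<Sum>v\<in>V - S. f (insert v (S - {u}))))"
    unfolding up_def down_def
  proof (intro sum.cong refl)
    fix u assume u: "u \<in> S"
    then have "V - (S - {u}) = insert u (V - S)" using S by auto
    then show "(\<Sum>v\<in>V - (S - {u}). f (insert v (S - {u}))) =
        f S + (\<Sum>v\<in>V - S. f (insert v (S - {u})))"
      using V u by (simp add: insert_absorb)
  qed
  also have "\<dots> = of_nat (card S) * f S + (\<Sum>v\<in>V - S. \<Sum>u\<in>S. f (insert v (S - {u})))"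
    by (simp add: sum.distrib sum.swap[of _ S])
  finally have 2: "up (down V f) S = \<dots>" .
  show ?thesis unfolding 1 2 by (simp add: algebra_simps)
qed

lemma down_cong: "(\<And>S. S \<subseteq> V \<Longrightarrow> f S = f' S) \<Longrightarrow> S \<subseteq> V \<Longrightarrow> down V f S = down V f' S"
  unfolding down_def by (intro sum.cong) auto

text \<open>The additive form also gives vanishing for \<open>m > d\<close>, where the descent in
  \<open>up_inj_edgeless\<close> starts.\<close>

lemma down_power_degree:
  fixes h :: "nat set \<Rightarrow> 'k::comm_ring_1"
  assumes V: "finite V" and h: "\<And>S. S \<subseteq> V \<Longrightarrow> h S \<noteq> 0 \<Longrightarrow> card S = d"
  shows "S \<subseteq> V \<Longrightarrow> (down V ^^ m) h S \<noteq> 0 \<Longrightarrow> card S + m = d"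
proof (induction m arbitrary: S)
  case 0
  then show ?case using h by simp
next
  case (Suc m)
  then have "\<exists>v\<in>V - S. (down V ^^ m) h (insert v S) \<noteq> 0"
    unfolding funpow.simps o_def down_def by (meson sum.neutral)
  then obtain v where v: "v \<in> V - S" "(down V ^^ m) h (insert v S) \<noteq> 0" by blast
  then have "card (insert v S) + m = d" using Suc by auto
  moreover have "finite S" using Suc.prems(1) V finite_subset by blast
  ultimately show ?case using v by simp
qed

text \<open>On the support of \<open>(down V ^^ m) h\<close> all sets have size
  \<open>d - m\<close>, so the factor \<open>card S - card (V - S)\<close> from the commutation
  relation is constant. It may be negative, hence the integers.\<close>

lemma up_down_step:
  fixes h :: "nat set \<Rightarrow> 'k::comm_ring_1"
  assumes V: "finite V" and h: "\<And>S. S \<subseteq> V \<Longrightarrow> h S \<noteq> 0 \<Longrightarrow> card S = d" and S: "S \<subseteq> V"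
  shows "up ((down V ^^ Suc m) h) S = down V (up ((down V ^^ m) h)) S +
    of_int (2 * (int d - int m) - int (card V)) * (down V ^^ m) h S"
proof -
  let ?f = "(down V ^^ m) h"
  have eq: "up (down V ?f) S + of_nat (card (V - S)) * ?f S =
      down V (up ?f) S + of_nat (card S) * ?f S"
    using up_down_commute[OF V S, of ?f] by simp
  have finS: "finite S" using S V finite_subset by blast
  have "card (V - S) + card S = card V"
    using S V finS by (metis card_Diff_subset card_mono le_add_diff_inverse2)
  then have "(of_int (int (card V)) :: 'k) = of_nat (card (V - S)) + of_nat (card S)"
    by (metis of_int_of_nat_eq of_nat_add)
  moreover have "?f S = 0 \<or> d = card S + m"
    using down_power_degree[of V h d S m, OF V _ S] h by fastforce
  ultimately have "?f S = 0 \<or>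
      of_int (2 * (int d - int m) - int (card V)) = of_nat (card S) - (of_nat (card (V - S)) :: 'k)"
    by (elim disjE) (simp_all add: algebra_simps)
  then show ?thesis
  proof
    assume "?f S = 0"
    then show ?thesis using eq by simp
  next
    assume "of_int (2 * (int d - int m) - int (card V)) =
      of_nat (card S) - (of_nat (card (V - S)) :: 'k)"
    then show ?thesis using eq by (simp only: left_diff_distrib) (simp add: algebra_simps)
  qed
qed

text \<open>Moving \<open>up\<close> through the factors \<open>down\<close> one at a time adds up
  the constants of \<open>up_down_step\<close>.\<close>

lemma up_down_power:
  fixes h :: "nat set \<Rightarrow> 'k::comm_ring_1"
  assumes V: "finite V" and h: "\<And>S. S \<subseteq> V \<Longrightarrow> h S \<noteq> 0 \<Longrightarrow> card S = d"
  shows "S \<subseteq> V \<Longrightarrow> up ((down V ^^ Suc m) h) S = (down V ^^ Suc m) (up h) S +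
    of_int (\<Sum>l\<le>m. 2 * (int d - int l) - int (card V)) * (down V ^^ m) h S"
proof (induction m arbitrary: S)
  case 0
  then show ?case using up_down_step[of V h d S 0, OF V h] by simp
next
  case (Suc m)
  let ?c = "of_int (\<Sum>l\<le>m. 2 * (int d - int l) - int (card V)) :: 'k"
  have "down V (up ((down V ^^ Suc m) h)) S =
      down V (\<lambda>S. (down V ^^ Suc m) (up h) S + ?c * (down V ^^ m) h S) S"
    by (rule down_cong[OF Suc.IH Suc.prems])
  also have "\<dots> = (down V ^^ Suc (Suc m)) (up h) S + ?c * (down V ^^ Suc m) h S"
    by (simp add: down_def sum.distrib sum_distrib_left)
  finally show ?case
    using up_down_step[of V h d S "Suc m", OF V h Suc.prems] by (simp add: algebra_simps)
qed

text \<open>For \<open>h\<close> of degree \<open>j\<close> killed by \<open>up\<close>,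
  \<open>up_down_power\<close> writes a nonzero multiple of \<open>(down V ^^ k) h\<close> as
  \<open>up\<close> of \<open>(down V ^^ Suc k) h\<close>. As \<open>(down V ^^ Suc j) h\<close>
  vanishes, descent in \<open>k\<close> reaches \<open>h\<close>.\<close>

lemma up_inj_edgeless:
  assumes V: "finite V" and E: "indep E V" and j: "2 * j < card V"
  shows "up_inj TYPE('k::field_char_0) E V j"
  unfolding up_inj_def
proof (intro allI impI)
  fix f :: "nat set \<Rightarrow> 'k" and S
  assume f: "\<forall>T. T \<subseteq> V \<longrightarrow> indep E T \<longrightarrow> card T = Suc j \<longrightarrow> up f T = 0"
    and S: "S \<subseteq> V" "card S = j"
  \<comment> \<open>Truncation to size \<open>j\<close> makes \<open>up h\<close> vanish on all
    subsets of \<open>V\<close>, not only on those of size \<open>Suc j\<close>.\<close>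
  define h where "h S = (if card S = j then f S else 0)" for S
  have h: "card S = j" if "h S \<noteq> 0" for S
    using that by (auto simp: h_def split: if_splits)
  have up_h: "up h T = 0" if T: "T \<subseteq> V" for T
  proof (cases "card T = Suc j")
    case True
    then have "up h T = up f T"
      unfolding up_def h_def by (intro sum.cong) auto
    then show ?thesis using f T True indep_mono[OF E] by simp
  next
    case False
    have "finite T" using T V finite_subset by blast
    then have "card (T - {v}) \<noteq> j" if "v \<in> T" for v
      using that False by (simp add: card_Diff_singleton_if) (metis Suc_pred card_gt_0_iff empty_iff)
    then show ?thesis by (simp add: up_def h_def)
  qed
  have down_up: "(down V ^^ m) (up h) S = 0" if "S \<subseteq> V" for m S
    using that
  proof (induction m arbitrary: S)
    case (Suc m)
    then show ?case by (auto simp: down_def intro!: sum.neutral)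
  qed (simp add: up_h)
  \<comment> \<open>Descent on the exponent, run upwards in \<open>m\<close>; natural subtraction
    stops it at exponent 0.\<close>
  have vanish: "(down V ^^ (Suc j - m)) h S = 0" if "S \<subseteq> V" for m S
    using that
  proof (induction m arbitrary: S)
    case 0
    then show ?case using down_power_degree[of V h j S "Suc j"] V h by fastforce
  next
    case (Suc m)
    show ?case
    proof (cases "m \<le> j")
      case True
      define k where "k = j - m"
      have k: "Suc j - m = Suc k" "Suc j - Suc m = k" using True by (auto simp: k_def)
      have "(down V ^^ Suc k) h T = 0" if "T \<subseteq> V" for T
        using Suc.IH[OF that] by (simp only: k)
      then have "up ((down V ^^ Suc k) h) S = 0"
        using Suc.prems unfolding up_def by (intro sum.neutral ballI) (meson Diff_subset subset_trans)
      then have "of_int (\<Sum>l\<le>k. 2 * (int j - int l) - int (card V)) * (down V ^^ k) h S = 0"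
        using up_down_power[of V h j S k, OF V h Suc.prems] down_up[OF Suc.prems, of "Suc k"] by simp
      \<comment> \<open>Every summand is at most \<open>2 * j - card V\<close>, which is
        negative.\<close>
      moreover have "(\<Sum>l\<le>k. 2 * (int j - int l) - int (card V)) < (\<Sum>l\<le>k. 0)"
        using j by (intro sum_strict_mono) auto
      then have "of_int (\<Sum>l\<le>k. 2 * (int j - int l) - int (card V)) \<noteq> (0::'k)"
        unfolding of_int_eq_0_iff by simp
      ultimately show ?thesis unfolding k by simp
    next
      case False
      then show ?thesis using Suc.IH[OF Suc.prems] by simp
    qed
  qed
  have "h S = 0" using vanish[OF S(1), of "Suc j"] by simp
  then show "f S = 0" using S by (simp add: h_def)
qed

text \<open>Each \<open>(down V ^^ i) ((up ^^ i) h)\<close> lies in the image of \<open>up\<close>: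
  trivially for \<open>i\<close> beyond \<open>card V\<close>, and \<open>up_down_power\<close>
  passes from \<open>Suc i\<close> to \<open>i\<close> after division by a positive constant. The
  case \<open>i = 0\<close> is \<open>h\<close> itself.\<close>

lemma up_surj_edgeless:
  assumes V: "finite V" and k: "card V < 2 * k"
  shows "up_surj TYPE('k::field_char_0) E V k"
  unfolding up_surj_def
proof (intro allI)
  fix g :: "nat set \<Rightarrow> 'k"
  define h where "h S = (if card S = k then g S else 0)" for S
  have deg: "card S = k + i" if "S \<subseteq> V" "(up ^^ i) h S \<noteq> 0" for i S
    using that
  proof (induction i arbitrary: S)
    case 0
    then show ?case by (auto simp: h_def split: if_splits)
  next
    case (Suc i)
    then have "\<exists>v\<in>S. (up ^^ i) h (S - {v}) \<noteq> 0"
      unfolding funpow.simps o_def up_def by (meson sum.neutral)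
    then obtain v where v: "v \<in> S" "(up ^^ i) h (S - {v}) \<noteq> 0" by blast
    then have "card (S - {v}) = k + i" by (intro Suc.IH) (use Suc.prems in auto)
    moreover have "finite S" using Suc.prems(1) V finite_subset by blast
    ultimately show ?case using v by (metis add_Suc_right card_Suc_Diff1)
  qed
  have reach: "\<exists>f. \<forall>S. S \<subseteq> V \<longrightarrow> up f S = (down V ^^ i) ((up ^^ i) h) S" if "i \<le> Suc (card V)" for i
    using that
  proof (induction rule: inc_induct)
    case base
    have "(up ^^ Suc (card V)) h S = 0" if "S \<subseteq> V" for S
      using deg[OF that, of "Suc (card V)"] card_mono[OF V that] by fastforce
    then have "(down V ^^ m) ((up ^^ Suc (card V)) h) S = 0" if "S \<subseteq> V" for m S
      using that
    proof (induction m arbitrary: S)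
      case (Suc m)
      then show ?case by (auto simp: down_def intro!: sum.neutral)
    qed simp
    moreover have "up (\<lambda>_. 0 :: 'k) S = 0" for S by (simp add: up_def)
    ultimately show ?case by (intro exI[of _ "\<lambda>_. 0"]) (simp del: funpow.simps)
  next
    case (step i)
    obtain f where f: "\<And>S. S \<subseteq> V \<Longrightarrow> up f S = (down V ^^ Suc i) ((up ^^ Suc i) h) S"
      using step.IH by blast
    define c :: int where "c = (\<Sum>l\<le>i. 2 * (int (k + i) - int l) - int (card V))"
    have "0 < c" unfolding c_def using k by (intro sum_pos) auto
    then have c: "of_int c \<noteq> (0::'k)" by simp
    define f' where "f' S = ((down V ^^ Suc i) ((up ^^ i) h) S - f S) / of_int c" for S
    have "up f' S = (down V ^^ i) ((up ^^ i) h) S" if S: "S \<subseteq> V" for S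
    proof -
      have "up f' S = (up ((down V ^^ Suc i) ((up ^^ i) h)) S - up f S) / of_int c"
        by (simp only: up_def f'_def sum_subtractf sum_divide_distrib diff_divide_distrib)
      also have "up ((down V ^^ Suc i) ((up ^^ i) h)) S =
          (down V ^^ Suc i) (up ((up ^^ i) h)) S + of_int c * (down V ^^ i) ((up ^^ i) h) S"
        unfolding c_def by (rule up_down_power[OF V deg S])
      finally show ?thesis using f[OF S] c by simp
    qed
    then show ?case by blast
  qed
  obtain f where "\<And>S. S \<subseteq> V \<Longrightarrow> up f S = h S"
    using reach[of 0] by auto
  then show "\<exists>f. \<forall>T. T \<subseteq> V \<longrightarrow> indep E T \<longrightarrow> card T = k \<longrightarrow> up f T = g T"
    unfolding h_def by (intro exI[of _ f]) simp
qed

section \<open>Reduction to edgeless graphs\<close>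

text \<open>The non-edges of a pentagon form a 5-cycle again, and the incidence matrix of an odd
  cycle is invertible where 2 is. Vertex deletion cannot settle this case: the non-neighbours of a
  vertex span a single edge, where surjectivity onto degree 1 fails.\<close>

lemma up_surj_pentagon:
  assumes E: "\<And>a b. a \<in> {1..5} \<Longrightarrow> b \<in> {1..5} \<Longrightarrow>
    {a, b} \<in> E \<longleftrightarrow> a = Suc b \<or> b = Suc a \<or> {a, b} = {1, 5}"
  shows "up_surj TYPE('k::field_char_0) E {1..5} 2"
  unfolding up_surj_def
proof (intro allI)
  fix g :: "nat set \<Rightarrow> 'k"
  \<comment> \<open>For the pentagon \<open>a, b, c, d, e\<close> the non-edges run through
    \<open>a, c, e, b, d\<close>; the alternating sum along this cycle telescopes to twice the value
    at \<open>a\<close>.\<close>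
  define alt where "alt a b c d e = (g {a, c} - g {c, e} + g {e, b} - g {b, d} + g {d, a}) / 2"
    for a b c d e
  define f where "f S = (if S = {1} then alt 1 2 3 4 5 else if S = {2} then alt 2 3 4 5 1
    else if S = {3} then alt 3 4 5 1 2 else if S = {4} then alt 4 5 1 2 3 else alt 5 1 2 3 4)" for S :: "nat set"
  have "up f T = g T" if T: "T \<subseteq> {1..5}" "indep E T" "card T = 2" for T
  proof -
    obtain a b where ab: "T = {a, b}" "a \<noteq> b" using T(3) by (auto simp: card_2_iff)
    have mem: "a \<in> {1..5}" "b \<in> {1..5}" using T(1) ab by auto
    have "{a, b} \<notin> E" using T(2) ab by (auto simp: indep_def)
    then have nonadj: "\<not> (a = Suc b \<or> b = Suc a \<or> {a, b} = {1, 5})" using E[OF mem] by blast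
    have "up f T = f {b} + f {a}"
      using ab by (simp add: up_def insert_Diff_if)
    moreover have "a = 1 \<or> a = 2 \<or> a = 3 \<or> a = 4 \<or> a = 5" "b = 1 \<or> b = 2 \<or> b = 3 \<or> b = 4 \<or> b = 5"
      using mem by auto
    then have "f {b} + f {a} = g {a, b}"
      using nonadj ab(2) by (elim disjE) (simp_all add: f_def alt_def insert_commute field_simps)
    ultimately show ?thesis using ab by simp
  qed
  then show "\<exists>f. \<forall>T. T \<subseteq> {1..5} \<longrightarrow> indep E T \<longrightarrow> card T = 2 \<longrightarrow> up f T = g T" by blast
qed

section \<open>Executable vertex deletion for tadpoles\<close>

definition adj5 :: "nat \<Rightarrow> nat \<Rightarrow> bool" where
  "adj5 u v \<longleftrightarrow> u = Suc v \<or> v = Suc u \<or> u = 1 \<and> v = 5 \<or> u = 5 \<and> v = 1"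

text \<open>
  The checkers repeatedly delete a neighbour of the first vertex that has one; \<open>k\<close> counts the
  vertices that are already isolated and have been removed from the list.\<close>

function inj_check :: "nat \<Rightarrow> nat list \<Rightarrow> nat \<Rightarrow> bool" where
  "inj_check k [] j = (2 * j < k)"
| "inj_check k (u # us) j = (case find (adj5 u) us of
     None \<Rightarrow> inj_check (Suc k) us j
   | Some v \<Rightarrow> inj_check k (u # filter (\<lambda>w. w \<noteq> v) us) j \<and>
       (j = 0 \<or> inj_check k (filter (\<lambda>w. w \<noteq> v \<and> \<not> adj5 v w) us) (j - 1)))"
  by pat_completeness auto
termination
  by (relation "measure (\<lambda>(k, us, j). length us)")
    (auto simp: find_Some_iff less_Suc_eq_le Suc_le_eq intro!: length_filter_less nth_mem)

function surj_check :: "nat \<Rightarrow> nat list \<Rightarrow> nat \<Rightarrow> bool" where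
  "surj_check k [] j = (k < 2 * j)"
| "surj_check k (u # us) j = (k = 0 \<and> j = 2 \<and> u # us = [5, 4, 3, 2, 1] \<or>
   (case find (adj5 u) us of
     None \<Rightarrow> surj_check (Suc k) us j
   | Some v \<Rightarrow> j \<noteq> 0 \<and> surj_check k (u # filter (\<lambda>w. w \<noteq> v) us) j \<and>
       surj_check k (filter (\<lambda>w. w \<noteq> v \<and> \<not> adj5 v w) us) (j - 1)))"
  by pat_completeness auto
termination
  by (relation "measure (\<lambda>(k, us, j). length us)")
    (auto simp: find_Some_iff less_Suc_eq_le Suc_le_eq intro!: length_filter_less nth_mem)

declare inj_check.simps(2) [simp del] surj_check.simps(2) [simp del]

text \<open>Invariant of the checkers on the induced subgraph with vertex set
  \<open>K \<union> set us\<close>: \<open>K\<close> collects the isolated vertices, of which the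
  checkers record only the number.\<close>

definition reduced :: "nat set set \<Rightarrow> nat set \<Rightarrow> nat list \<Rightarrow> bool" where
  "reduced E K us \<longleftrightarrow> distinct us \<and> finite K \<and> K \<inter> set us = {} \<and>
     (\<forall>a\<in>K. \<forall>b\<in>K \<union> set us. {a, b} \<notin> E) \<and>
     (\<forall>a\<in>set us. \<forall>b\<in>set us. {a, b} \<in> E \<longleftrightarrow> adj5 a b)"

lemma reduced_Nil: "reduced E K [] \<Longrightarrow> finite K \<and> indep E K"
  by (auto simp: reduced_def indep_def)

lemma adj5_sym: "adj5 a b = adj5 b a"
  by (auto simp: adj5_def)

lemma adj5_irrefl: "\<not> adj5 a a"
  by (auto simp: adj5_def)

lemma reduced_isolate:
  assumes "reduced E K (u # us)" "find (adj5 u) us = None"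
  shows "reduced E (insert u K) us"
  using assms adj5_irrefl[of u] unfolding reduced_def find_None_iff
  by (auto simp: insert_commute adj5_sym)

text \<open>Matches the two recursive calls with the two vertex sets of the deletion lemmas. The
  second list omits \<open>u\<close> because \<open>u\<close> is a neighbour of \<open>v\<close>,
  while all of \<open>K\<close> survives.\<close>

lemma reduced_delete:
  assumes "reduced E K (u # us)" "find (adj5 u) us = Some v"
  shows "reduced E K (u # filter (\<lambda>w. w \<noteq> v) us)"
    and "K \<union> set (u # filter (\<lambda>w. w \<noteq> v) us) = K \<union> set (u # us) - {v}"
    and "reduced E K (filter (\<lambda>w. w \<noteq> v \<and> \<not> adj5 v w) us)"
    and "K \<union> set (filter (\<lambda>w. w \<noteq> v \<and> \<not> adj5 v w) us) =
      {w \<in> K \<union> set (u # us) - {v}. {v, w} \<notin> E}"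
proof -
  have v: "v \<in> set us" "adj5 u v" using assms(2) by (auto simp: find_Some_iff)
  then have uv: "{v, u} \<in> E" "u \<noteq> v" "v \<notin> K"
    using assms(1) by (auto simp: reduced_def adj5_sym)
  have K: "{v, w} \<notin> E" if "w \<in> K" for w
  proof -
    have "{w, v} \<notin> E" using assms(1) that v(1) by (simp add: reduced_def)
    then show ?thesis by (simp add: insert_commute)
  qed
  have us: "{v, w} \<in> E \<longleftrightarrow> adj5 v w" if "w \<in> set us" for w
    using assms(1) that v(1) by (auto simp: reduced_def)
  show "reduced E K (u # filter (\<lambda>w. w \<noteq> v) us)"
    "reduced E K (filter (\<lambda>w. w \<noteq> v \<and> \<not> adj5 v w) us)"
    using assms(1) by (auto simp: reduced_def)
  show "K \<union> set (u # filter (\<lambda>w. w \<noteq> v) us) = K \<union> set (u # us) - {v}"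
    using uv by auto
  show "K \<union> set (filter (\<lambda>w. w \<noteq> v \<and> \<not> adj5 v w) us) =
      {w \<in> K \<union> set (u # us) - {v}. {v, w} \<notin> E}"
    using uv K us by auto
qed

lemma inj_check_sound:
  assumes E: "simple_graph N E"
  shows "inj_check k us j \<Longrightarrow> reduced E K us \<Longrightarrow> card K = k \<Longrightarrow>
    up_inj TYPE('k::field_char_0) E (K \<union> set us) j"
proof (induction k us j arbitrary: K rule: inj_check.induct)
  case (1 k j)
  then show ?case using up_inj_edgeless[of K E j] reduced_Nil by auto
next
  case (2 k u us j)
  note chk = iffD1[OF inj_check.simps(2) 2(4)]
  show ?case
  proof (cases "find (adj5 u) us")
    case None
    have "u \<notin> K" "finite K" using 2(5) by (auto simp: reduced_def)
    then have "up_inj TYPE('k) E (insert u K \<union> set us) j"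
      using 2(1)[OF None _ reduced_isolate[OF 2(5) None]] chk 2(6) None by auto
    then show ?thesis by simp
  next
    case (Some v)
    note red = reduced_delete[OF 2(5) Some]
    let ?V = "K \<union> set (u # us)"
    have fin: "finite ?V" using 2(5) by (auto simp: reduced_def)
    have "up_inj TYPE('k) E (?V - {v}) j"
      using 2(2)[OF Some _ red(1) 2(6)] chk Some unfolding red(2) by simp
    moreover have "j = 0 \<or> up_inj TYPE('k) E {w \<in> ?V - {v}. {v, w} \<notin> E} (j - 1)"
      using 2(3)[OF Some _ red(3) 2(6)] chk Some unfolding red(4) by auto
    ultimately show ?thesis by (rule up_inj_vertex[OF E fin refl])
  qed
qed

lemma surj_check_sound:
  assumes E: "simple_graph N E"
  shows "surj_check k us j \<Longrightarrow> reduced E K us \<Longrightarrow> card K = k \<Longrightarrow>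
    up_surj TYPE('k::field_char_0) E (K \<union> set us) j"
proof (induction k us j arbitrary: K rule: surj_check.induct)
  case (1 k j)
  then show ?case using up_surj_edgeless[of K j E] reduced_Nil by auto
next
  case (2 k u us j)
  note chk = iffD1[OF surj_check.simps(2) 2(4)]
  show ?case
  proof (cases "k = 0 \<and> j = 2 \<and> u # us = [5, 4, 3, 2, 1]")
    \<comment> \<open>The pentagon base case; \<open>k = 0\<close> forces \<open>K\<close> to be
      empty.\<close>
    case True
    have us: "set (u # us) = {1..5}"
    proof -
      have "set [5, 4, 3, 2, 1] = {1..5::nat}" by auto
      then show ?thesis using True by metis
    qed
    have "finite K" using 2(5) unfolding reduced_def by blast
    then have V: "K \<union> set (u # us) = {1..5}"
      using 2(6) True us by (metis card_0_eq sup_bot_left)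
    have "{a, b} \<in> E \<longleftrightarrow> a = Suc b \<or> b = Suc a \<or> {a, b} = {1, 5}" if "a \<in> {1..5}" "b \<in> {1..5}" for a b
    proof -
      have "{a, b} \<in> E \<longleftrightarrow> adj5 a b"
        using 2(5) that unfolding reduced_def us by blast
      then show ?thesis by (auto simp: adj5_def doubleton_eq_iff)
    qed
    then show ?thesis unfolding V using up_surj_pentagon[of E] True by blast
  next
    case False
    with chk have chk: "case find (adj5 u) us of
        None \<Rightarrow> surj_check (Suc k) us j
      | Some v \<Rightarrow> j \<noteq> 0 \<and> surj_check k (u # filter (\<lambda>w. w \<noteq> v) us) j \<and>
         surj_check k (filter (\<lambda>w. w \<noteq> v \<and> \<not> adj5 v w) us) (j - 1)" by blast
    show ?thesis
    proof (cases "find (adj5 u) us")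
      case None
      have "u \<notin> K" "finite K" using 2(5) by (auto simp: reduced_def)
      then have "up_surj TYPE('k) E (insert u K \<union> set us) j"
        using 2(1)[OF None _ reduced_isolate[OF 2(5) None]] chk 2(6) None by auto
      then show ?thesis by simp
    next
      case (Some v)
      note red = reduced_delete[OF 2(5) Some]
      let ?V = "K \<union> set (u # us)"
      have fin: "finite ?V" using 2(5) by (auto simp: reduced_def)
      obtain j' where j: "j = Suc j'" using chk Some by (cases j) auto
      have "up_surj TYPE('k) E (?V - {v}) (Suc j')"
        using 2(2)[OF Some _ red(1) 2(6)] chk Some unfolding red(2) j by simp
      moreover have "up_surj TYPE('k) E {w \<in> ?V - {v}. {v, w} \<notin> E} j'"
        using 2(3)[OF Some _ red(3) 2(6)] chk Some unfolding red(4) j by simp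
      ultimately show ?thesis unfolding j by (rule up_surj_vertex[OF E fin refl])
    qed
  qed
qed

text \<open>The reversed list starts at the free end of the tail, so that the cycle comes last, in
  the order that the pentagon case of \<open>surj_check\<close> expects.\<close>

lemma check_small:
  "\<forall>n\<in>{1, 2, 3, 5, 6, 9}. \<forall>j\<in>set [0..<5 + n].
     inj_check 0 (rev [1..<6 + n]) j \<or> surj_check 0 (rev [1..<6 + n]) (Suc j)"
  by code_simp

section \<open>Transfer to the algebra\<close>

lemma lookup_sum_Var_mult_mon:
  fixes f :: "'k::comm_ring_1 mpoly"
  assumes "T \<subseteq> {1..N}"
  shows "Poly_Mapping.lookup ((\<Sum>i\<in>{1..N}. Var i) * f) (mon T) =
    up (\<lambda>S. Poly_Mapping.lookup f (mon S)) T"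
proof -
  have l: "(\<Sum>i\<in>{1..N}. Var i) \<in> (forms {1..N} 1 :: 'k mpoly set)"
    by (intro sum_in_forms Var_in_forms)
  have "finite T" using assms finite_subset by blast
  then have "Poly_Mapping.lookup ((\<Sum>i\<in>{1..N}. Var i) * f) (mon T) =
      (\<Sum>v\<in>T. Poly_Mapping.lookup (\<Sum>i\<in>{1..N}. Var i) (Poly_Mapping.single v 1) *
        Poly_Mapping.lookup f (mon (T - {v})))"
    by (rule lookup_linear_mult_mon[OF l finite_atLeastAtMost])
  also have "\<dots> = up (\<lambda>S. Poly_Mapping.lookup f (mon S)) T"
    unfolding up_def
  proof (intro sum.cong refl)
    fix v assume "v \<in> T"
    then have "v \<in> {1..N}" using assms by blast
    then show "Poly_Mapping.lookup (\<Sum>i\<in>{1..N}. Var i) (Poly_Mapping.single v 1) *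
        Poly_Mapping.lookup f (mon (T - {v})) = Poly_Mapping.lookup f (mon (T - {v}))"
      using lookup_sum_Var[of "{1..N}" v, where 'k = 'k] by simp
  qed
  finally show ?thesis .
qed

lemma mult_inj_if_up_inj:
  assumes E: "simple_graph N E" and inj: "up_inj TYPE('k::comm_ring_1) E {1..N} j"
  shows "mult_inj TYPE('k) N E (\<Sum>i\<in>{1..N}. Var i) j"
  unfolding mult_inj_def
proof (intro ballI impI)
  fix f :: "'k mpoly"
  assume f: "f \<in> homog N j" and lf: "(\<Sum>i\<in>{1..N}. Var i) * f \<in> artin_ideal TYPE('k) N E"
  have "up (\<lambda>S. Poly_Mapping.lookup f (mon S)) T = 0" if "T \<subseteq> {1..N}" "indep E T" for T
    using lf that lookup_sum_Var_mult_mon[OF that(1), of f] unfolding artin_ideal_iff[OF E] by metis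
  then have "\<forall>S. S \<subseteq> {1..N} \<longrightarrow> indep E S \<longrightarrow> card S = j \<longrightarrow> Poly_Mapping.lookup f (mon S) = 0"
    using inj unfolding up_inj_def by blast
  then show "f \<in> artin_ideal TYPE('k) N E"
    using forms_artin_ideal_iff[OF E] f unfolding homog_eq_forms by blast
qed

lemma mult_surj_if_up_surj:
  assumes E: "simple_graph N E" and surj: "up_surj TYPE('k::comm_ring_1) E {1..N} (Suc j)"
  shows "mult_surj TYPE('k) N E (\<Sum>i\<in>{1..N}. Var i) j"
  unfolding mult_surj_def
proof
  fix g :: "'k mpoly"
  assume g: "g \<in> homog N (Suc j)"
  obtain h where h: "\<And>T. T \<subseteq> {1..N} \<Longrightarrow> indep E T \<Longrightarrow> card T = Suc j \<Longrightarrow>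
      up h T = Poly_Mapping.lookup g (mon T)"
    using surj unfolding up_surj_def by (elim allE[of _ "\<lambda>T. Poly_Mapping.lookup g (mon T)"]) blast
  let ?X = "{S. S \<subseteq> {1..N} \<and> card S = j}"
  define f where "f = (\<Sum>S\<in>?X. Poly_Mapping.single (mon S) (h S))"
  have finX: "finite ?X" by (rule finite_subset[of _ "Pow {1..N}"]) auto
  have fin: "finite S" if "S \<subseteq> {1..N}" for S using that finite_subset by blast
  have f: "f \<in> forms {1..N} j"
    unfolding f_def by (intro sum_in_forms single_mon_in_forms) (auto intro: finite_subset)
  have lookup_f: "Poly_Mapping.lookup f (mon S) = h S" if S: "S \<in> ?X" for S
  proof -
    have "Poly_Mapping.lookup f (mon S) = (\<Sum>S'\<in>?X. if S' = S then h S' else 0)"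
      unfolding f_def lookup_sum lookup_single when_def
      by (intro sum.cong refl if_cong mon_inject) (use S fin in auto)
    then show ?thesis using finX S by simp
  qed
  let ?l = "\<Sum>i\<in>{1..N}. Var i :: 'k mpoly"
  have "?l \<in> forms {1..N} 1" by (intro sum_in_forms Var_in_forms)
  then have "?l * f \<in> forms {1..N} (Suc j)" using mult_in_forms[OF _ f] by fastforce
  then have mem: "g - ?l * f \<in> forms {1..N} (Suc j)"
    using add_in_forms[OF _ uminus_in_forms, of g _ _ "?l * f"] g by (simp add: homog_eq_forms)
  have "Poly_Mapping.lookup (g - ?l * f) (mon T) = 0"
    if T: "T \<subseteq> {1..N}" "indep E T" "card T = Suc j" for T
  proof -
    have "up (\<lambda>S. Poly_Mapping.lookup f (mon S)) T = up h T"
      unfolding up_def using T fin[OF T(1)] by (intro sum.cong refl lookup_f) auto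
    then show ?thesis
      using h[OF T] by (simp only: lookup_minus lookup_sum_Var_mult_mon[OF T(1)] diff_self)
  qed
  then have "g - ?l * f \<in> artin_ideal TYPE('k) N E"
    using forms_artin_ideal_iff[OF E mem] by blast
  then show "\<exists>f\<in>homog N j. g - ?l * f \<in> artin_ideal TYPE('k) N E"
    using f unfolding homog_eq_forms by blast
qed

text \<open>Places the degree in which the property fails below the socle degree. The bound by
  \<open>N\<close> makes the \<open>GREATEST\<close> in \<open>top_degree\<close> a genuine
  maximum.\<close>

lemma card_le_top_degree:
  assumes E: "simple_graph N E" and T: "T \<subseteq> {1..N}" "indep E T"
  shows "card T \<le> top_degree TYPE('k::comm_ring_1) N E"
  unfolding top_degree_def
proof (rule Greatest_le_nat)
  have fin: "finite S" if "S \<subseteq> {1..N}" for S using that finite_subset by blast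
  have "Poly_Mapping.single (mon T) (1::'k) \<in> forms {1..N} (card T)"
    by (rule single_mon_in_forms) (use T fin in auto)
  moreover have "Poly_Mapping.single (mon T) (1::'k) \<notin> artin_ideal TYPE('k) N E"
    unfolding artin_ideal_iff[OF E] using T by (auto intro!: exI[of _ T])
  ultimately show "\<exists>f\<in>homog N (card T). (f :: 'k mpoly) \<notin> artin_ideal TYPE('k) N E"
    unfolding homog_eq_forms by blast
next
  fix j
  assume "\<exists>f\<in>homog N j. (f :: 'k mpoly) \<notin> artin_ideal TYPE('k) N E"
  then obtain S where "S \<subseteq> {1..N}" "card S = j"
    using forms_artin_ideal_iff[OF E] unfolding homog_eq_forms by blast
  then show "j \<le> N" using card_mono[of "{1..N}" S] by simp
qed

section \<open>Failure of surjectivity\<close>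

text \<open>The functional \<open>\<Sum>T. W T * coeff T\<close> vanishes on all multiples of \<open>l\<close>, because
  exchanging \<open>v\<close> for its partner \<open>\<pi> v\<close> in \<open>T\<close> cancels the terms in pairs.\<close>

lemma not_mult_surj_if_matching:
  fixes l :: "'k::field_char_0 mpoly"
  assumes E: "simple_graph N E" and l: "l \<in> homog N 1"
    and U: "U \<subseteq> {1..N}"
    and invol: "\<And>v. v \<in> U \<Longrightarrow> \<pi> v \<in> U \<and> \<pi> (\<pi> v) = v"
    and edges: "\<And>u v. u \<in> U \<Longrightarrow> v \<in> U \<Longrightarrow> {u, v} \<in> E \<longleftrightarrow> v = \<pi> u"
    and T0: "T0 \<subseteq> U" "indep E T0" "card T0 = Suc j"
    and cover: "\<And>v. v \<in> U \<Longrightarrow> v \<notin> T0 \<Longrightarrow> \<pi> v \<in> T0"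
    and coeffs: "\<And>v. v \<in> T0 \<Longrightarrow> Poly_Mapping.lookup l (Poly_Mapping.single (\<pi> v) 1) \<noteq> 0 \<or>
      Poly_Mapping.lookup l (Poly_Mapping.single v 1) = 0"
  shows "\<not> mult_surj TYPE('k) N E l j"
proof
  assume surj: "mult_surj TYPE('k) N E l j"
  let ?a = "\<lambda>v. Poly_Mapping.lookup l (Poly_Mapping.single v (1::nat))"
  have fin: "finite S" if "S \<subseteq> U" for S using that U finite_subset by (metis finite_atLeastAtMost)
  \<comment> \<open>Weight 1 on \<open>T0\<close> forces the weights of the partners through
    \<open>?a v * w v + ?a (\<pi> v) * w (\<pi> v) = 0\<close>. By \<open>coeffs\<close> a zero
    denominator occurs only when both coefficients vanish, and then the relation is trivial.\<close>
  define w where "w v = (if v \<in> T0 then 1 else - ?a (\<pi> v) / ?a v)" for v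
  define W where "W T = (\<Prod>v\<in>T. w v)" for T
  have indep_iff: "indep E T \<longleftrightarrow> (\<forall>v\<in>T. \<pi> v \<notin> T)" if "T \<subseteq> U" for T
    using that edges unfolding indep_def by blast
  have w0: "?a v * w v + ?a (\<pi> v) * w (\<pi> v) = 0" if "v \<in> T0" for v
  proof -
    have "v \<in> U" "\<pi> v \<notin> T0" using that T0 indep_iff by blast+
    then show ?thesis using coeffs[OF that] that invol by (auto simp: w_def)
  qed
  have w: "?a v * w v + ?a (\<pi> v) * w (\<pi> v) = 0" if "v \<in> U" for v
  proof (cases "v \<in> T0")
    case False
    then show ?thesis using w0[OF cover[OF that False]] invol[OF that] by (simp add: add.commute)
  qed (rule w0)
  obtain f where f: "Poly_Mapping.single (mon T0) 1 - l * f \<in> artin_ideal TYPE('k) N E"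
  proof -
    have "Poly_Mapping.single (mon T0) (1::'k) \<in> homog N (Suc j)"
      unfolding homog_eq_forms by (rule single_mon_in_forms) (use T0 U fin in auto)
    then show ?thesis using that surj unfolding mult_surj_def by blast
  qed
  define F where "F S = Poly_Mapping.lookup f (mon S)" for S
  define Tr where "Tr = {T. T \<subseteq> U \<and> indep E T \<and> card T = Suc j}"
  \<comment> \<open>The functional on \<open>l * f\<close> is a sum over sets with a marked element.
    The map \<open>\<phi>\<close> exchanges the marked element for its partner and keeps the
    remaining set \<open>T - {v}\<close>.\<close>
  define X where "X = Sigma Tr (\<lambda>T. T)"
  define h where "h = (\<lambda>(T, v). W T * (?a v * F (T - {v})))"
  define \<phi> where "\<phi> = (\<lambda>(T, v). (insert (\<pi> v) (T - {v}), \<pi> v))"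
  have finU: "finite U" using fin by blast
  have finTr: "finite Tr" by (rule finite_subset[of _ "Pow U"]) (auto simp: Tr_def finU)
  have swap: "\<phi> x \<in> X \<and> \<phi> (\<phi> x) = x \<and> h (\<phi> x) = - h x" if x: "x \<in> X" for x
  proof -
    obtain T v where Tv: "x = (T, v)" "T \<subseteq> U" "indep E T" "card T = Suc j" "v \<in> T"
      using x by (auto simp: X_def Tr_def)
    define S where "S = T - {v}"
    have S: "T = insert v S" "v \<notin> S" "finite S" using Tv fin[OF Tv(2)] by (auto simp: S_def)
    have vU: "v \<in> U" "\<pi> v \<in> U" "\<pi> (\<pi> v) = v" using Tv invol by blast+
    have \<pi>v: "\<pi> v \<notin> T" using Tv indep_iff by blast
    then have ne: "\<pi> v \<noteq> v" "\<pi> v \<notin> S" using S by auto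
    have "\<forall>u\<in>insert (\<pi> v) S. \<pi> u \<notin> insert (\<pi> v) S"
    proof
      fix u assume "u \<in> insert (\<pi> v) S"
      then consider "u = \<pi> v" | "u \<in> S" by blast
      then show "\<pi> u \<notin> insert (\<pi> v) S"
      proof cases
        case 1
        then show ?thesis using vU ne S by auto
      next
        case 2
        then have "\<pi> u \<notin> T" "u \<in> U" "u \<noteq> v" using Tv indep_iff S by blast+
        moreover have "\<pi> u \<noteq> \<pi> v" using \<open>u \<in> U\<close> \<open>u \<noteq> v\<close> vU invol by metis
        ultimately show ?thesis using S by simp
      qed
    qed
    moreover have "insert (\<pi> v) S \<subseteq> U" using vU Tv S by auto
    ultimately have "(insert (\<pi> v) S, \<pi> v) \<in> X"
      using Tv(4) S ne by (simp add: X_def Tr_def indep_iff)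
    moreover have \<phi>x: "\<phi> x = (insert (\<pi> v) S, \<pi> v)"
      by (simp add: \<phi>_def Tv(1) S_def)
    moreover have "\<phi> (\<phi> x) = x"
      unfolding \<phi>x using ne S vU Tv(1) by (simp add: \<phi>_def)
    moreover have "h x + h (\<phi> x) = 0"
    proof -
      have "h x = w v * W S * (?a v * F S)"
        using S by (simp add: h_def Tv(1) W_def)
      moreover have "h (\<phi> x) = w (\<pi> v) * W S * (?a (\<pi> v) * F S)"
        unfolding \<phi>x using S ne by (simp add: h_def W_def)
      ultimately have "h x + h (\<phi> x) = W S * F S * (?a v * w v + ?a (\<pi> v) * w (\<pi> v))"
        by (simp add: algebra_simps)
      then show ?thesis using w[OF vU(1)] by simp
    qed
    ultimately show ?thesis by (simp add: eq_neg_iff_add_eq_0 add.commute)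
  qed
  have "sum h X = (\<Sum>x\<in>X. - h x)"
    by (rule sum.reindex_bij_witness[of _ \<phi> \<phi>]) (simp_all add: swap)
  then have "sum h X + sum h X = 0" by (simp add: sum_negf)
  then have "2 * sum h X = 0" by (simp only: mult_2)
  then have zero: "sum h X = 0" by simp
  \<comment> \<open>The functional is evaluated at \<open>mon T0\<close>, which agrees with
    \<open>l * f\<close> modulo the ideal: one side is \<open>W T0 = 1\<close>, the other
    \<open>sum h X = 0\<close>.\<close>
  have "W T0 = (\<Sum>T\<in>Tr. if T = T0 then W T else 0)"
    using finTr T0 by (simp add: Tr_def)
  also have "\<dots> = (\<Sum>T\<in>Tr. \<Sum>v\<in>T. h (T, v))"
  proof (intro sum.cong refl)
    fix T assume "T \<in> Tr"
    then have T: "T \<subseteq> U" "T \<subseteq> {1..N}" "indep E T" using U by (auto simp: Tr_def)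
    have l': "l \<in> forms {1..N} 1" using l by (simp add: homog_eq_forms)
    have "Poly_Mapping.lookup (Poly_Mapping.single (mon T0) 1 - l * f) (mon T) = 0"
      using f T unfolding artin_ideal_iff[OF E] by blast
    then have "Poly_Mapping.lookup (l * f) (mon T) = (if T = T0 then 1 else 0)"
      using mon_inject[OF fin[OF T(1)] fin[OF T0(1)]]
      by (auto simp: lookup_minus lookup_single when_def)
    moreover have "Poly_Mapping.lookup (l * f) (mon T) = (\<Sum>v\<in>T. ?a v * F (T - {v}))"
      unfolding F_def by (rule lookup_linear_mult_mon[OF l' finite_atLeastAtMost fin[OF T(1)]])
    ultimately show "(if T = T0 then W T else 0) = (\<Sum>v\<in>T. h (T, v))"
      by (simp add: h_def flip: sum_distrib_left)
  qed
  also have "\<dots> = sum h X"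
    unfolding X_def using finTr fin by (subst sum.Sigma) (auto simp: Tr_def)
  finally have "W T0 = 0" using zero by simp
  moreover have "W T0 = 1" by (simp add: W_def w_def)
  ultimately show False by simp
qed

section \<open>The tadpole graphs\<close>

text \<open>As \<open>y_1\<close> has number 6, the bridge and the tail continue the numbering of
  the cycle, and \<open>{1, 5}\<close> is the only edge between non-consecutive numbers. Adjacency
  is thus uniform in \<open>n\<close>.\<close>

lemma tadpole5_edge_iff:
  assumes "n \<ge> 1"
  shows "{u, v} \<in> tadpole_edges 5 n \<longleftrightarrow> u \<in> {1..5 + n} \<and> v \<in> {1..5 + n} \<and> adj5 u v"
proof
  assume "{u, v} \<in> tadpole_edges 5 n"
  then show "u \<in> {1..5 + n} \<and> v \<in> {1..5 + n} \<and> adj5 u v"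
    using assms unfolding tadpole_edges_def by (auto simp: doubleton_eq_iff adj5_def)
next
  have edge: "{u, Suc u} \<in> tadpole_edges 5 n" if "u \<in> {1..5 + n}" "Suc u \<in> {1..5 + n}" for u
  proof -
    consider "u \<le> 4" | "u = 5" | "u \<ge> 6" by linarith
    then show ?thesis
    proof cases
      case 1
      then have "{u, Suc u} = {u, u + 1} \<and> 1 \<le> u \<and> u \<le> 5 - 1" using that by auto
      then show ?thesis unfolding tadpole_edges_def by blast
    next
      case 2
      then show ?thesis unfolding tadpole_edges_def by simp
    next
      case 3
      then have "{u, Suc u} = {5 + (u - 5), 5 + (u - 5) + 1} \<and> 1 \<le> u - 5 \<and> u - 5 \<le> n - 1"
        using that by auto
      then show ?thesis unfolding tadpole_edges_def by blast
    qed
  qed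
  have "{5, 1} \<in> tadpole_edges 5 n" unfolding tadpole_edges_def by simp
  moreover assume "u \<in> {1..5 + n} \<and> v \<in> {1..5 + n} \<and> adj5 u v"
  ultimately show "{u, v} \<in> tadpole_edges 5 n"
    using edge[of u] edge[of v] by (auto simp: adj5_def insert_commute)
qed

lemma simple_graph_tadpole5: "n \<ge> 1 \<Longrightarrow> simple_graph (5 + n) (tadpole_edges 5 n)"
  using adj5_irrefl by (auto simp: simple_graph_def tadpole5_edge_iff)

lemma indep_tadpole5:
  assumes "n \<ge> 1" "S \<subseteq> {1..5 + n}"
  shows "indep (tadpole_edges 5 n) S \<longleftrightarrow> (\<forall>u\<in>S. \<forall>v\<in>S. \<not> adj5 u v)"
  using assms(2) unfolding indep_def tadpole5_edge_iff[OF assms(1)] by blast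

lemma WLP_small:
  assumes n: "n \<in> {1, 2, 3, 5, 6, 9}"
  shows "has_WLP TYPE('k::field_char_0) (5 + n) (tadpole_edges 5 n)"
proof -
  let ?N = "5 + n" and ?E = "tadpole_edges 5 n" and ?l = "\<Sum>i\<in>{1..5 + n}. Var i :: 'k mpoly"
  have n1: "n \<ge> 1" using n by auto
  note E = simple_graph_tadpole5[OF n1]
  have us: "set (rev [1..<6 + n]) = {1..?N}" by auto
  have red: "reduced ?E {} (rev [1..<6 + n])"
    unfolding reduced_def us by (simp add: tadpole5_edge_iff[OF n1])
  have "mult_inj TYPE('k) ?N ?E ?l j \<or> mult_surj TYPE('k) ?N ?E ?l j" for j
  proof (cases "j < ?N")
    case True
    then consider "inj_check 0 (rev [1..<6 + n]) j" | "surj_check 0 (rev [1..<6 + n]) (Suc j)"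
      using check_small n by fastforce
    then show ?thesis
    proof cases
      case 1
      then have "up_inj TYPE('k) ?E {1..?N} j"
        using inj_check_sound[OF E 1 red] us by simp
      then show ?thesis using mult_inj_if_up_inj[OF E] by blast
    next
      case 2
      then have "up_surj TYPE('k) ?E {1..?N} (Suc j)"
        using surj_check_sound[OF E 2 red] us by simp
      then show ?thesis using mult_surj_if_up_surj[OF E] by blast
    qed
  next
    case False
    \<comment> \<open>No subset has size \<open>Suc j\<close>, so surjectivity is vacuous.\<close>
    then have "card T \<noteq> Suc j" if "T \<subseteq> {1..?N}" for T
      using card_mono[OF _ that] by auto
    then have "up_surj TYPE('k) ?E {1..?N} (Suc j)"
      unfolding up_surj_def by blast
    then show ?thesis using mult_surj_if_up_surj[OF E] by blast
  qed
  moreover have "?l \<in> homog ?N 1"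
    unfolding homog_eq_forms by (intro sum_in_forms Var_in_forms)
  ultimately show ?thesis unfolding has_WLP_def by blast
qed

text \<open>In a path on \<open>2 * r + 1\<close> vertices only the set of odd vertices is
  independent of size \<open>r + 1\<close>; the chord between 1 and 5, present since
  \<open>r \<ge> 2\<close>, rules it out. Formally, \<open>S\<close> is covered by \<open>r\<close>
  cliques.\<close>

lemma card_indep_cycle_side:
  assumes S: "S \<subseteq> {1..2 * r + 1}" and ind: "\<forall>u\<in>S. \<forall>v\<in>S. \<not> adj5 u v" and r: "r \<ge> 2"
  shows "card S \<le> r"
proof (cases "1 \<in> S")
  case False
  \<comment> \<open>The edges \<open>{2, 3}\<close>, \<open>{4, 5}\<close>, ..., named by
    \<open>v div 2\<close>, cover \<open>S\<close>.\<close>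
  have "inj_on (\<lambda>v. v div 2) S"
  proof (rule inj_onI)
    fix u v assume uv: "u \<in> S" "v \<in> S" "u div 2 = v div 2"
    then have "u = v \<or> u = Suc v \<or> v = Suc u" by presburger
    then show "u = v" using ind uv by (auto simp: adj5_def)
  qed
  moreover have "(\<lambda>v. v div 2) ` S \<subseteq> {1..r}"
  proof safe
    fix v assume "v \<in> S"
    then have "1 \<le> v" "v \<le> 2 * r + 1" "v \<noteq> 1" using S False by auto
    then show "v div 2 \<in> {1..r}" by auto
  qed
  ultimately show ?thesis using card_inj_on_le[of _ S "{1..r}"] by simp
next
  case True
  txt \<open>The cliques \<open>{1}, {3, 4}, {6, 7}, {8, 9}, \<dots>\<close> cover \<open>S\<close>, as it avoids \<open>2\<close> and \<open>5\<close>.\<close>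
  define c where "c v = (if v = 1 then 1 else if v = 3 then 2 else v div 2)" for v :: nat
  have ne: "v \<noteq> 2" "v \<noteq> 5" if "v \<in> S" for v
  proof -
    have "\<not> adj5 1 v" using ind True that by blast
    then show "v \<noteq> 2" "v \<noteq> 5" by (auto simp: adj5_def)
  qed
  have "inj_on c S"
  proof (rule inj_onI)
    fix u v assume uv: "u \<in> S" "v \<in> S" "c u = c v"
    then have "u \<ge> 1" "v \<ge> 1" using S by auto
    then have "u = v \<or> u = Suc v \<or> v = Suc u"
    proof -
      have "u div 2 = v div 2" if "u \<noteq> 1" "u \<noteq> 3" "v \<noteq> 1" "v \<noteq> 3"
        using uv(3) that by (simp add: c_def)
      moreover have "v = 4" if "u = 3" "v \<noteq> 1" "v \<noteq> 3"
      proof -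
        have "v div 2 = 2" using uv(3) that by (simp add: c_def)
        then show ?thesis using ne(2)[OF uv(2)] by presburger
      qed
      moreover have "u = 4" if "v = 3" "u \<noteq> 1" "u \<noteq> 3"
      proof -
        have "u div 2 = 2" using uv(3) that by (simp add: c_def)
        then show ?thesis using ne(2)[OF uv(1)] by presburger
      qed
      moreover have "v = 1" if "u = 1"
      proof (rule ccontr)
        assume "v \<noteq> 1"
        then have "v \<noteq> 3" "v div 2 = 1" using uv(3) that by (auto simp: c_def split: if_splits)
        then show False using ne(1)[OF uv(2)] by presburger
      qed
      moreover have "u = 1" if "v = 1"
      proof (rule ccontr)
        assume "u \<noteq> 1"
        then have "u \<noteq> 3" "u div 2 = 1" using uv(3) that by (auto simp: c_def split: if_splits)
        then show False using ne(1)[OF uv(1)] by presburger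
      qed
      ultimately show ?thesis by presburger
    qed
    then show "u = v" using ind uv by (auto simp: adj5_def)
  qed
  moreover have "c ` S \<subseteq> {1..r}"
  proof safe
    fix v assume "v \<in> S"
    then have "1 \<le> v" "v \<le> 2 * r + 1" using S by auto
    then show "c v \<in> {1..r}" using r by (auto simp: c_def)
  qed
  ultimately show ?thesis using card_inj_on_le[of _ S "{1..r}"] by simp
qed

text \<open>The \<open>2 * r\<close> vertices pair into \<open>r\<close> edges
  \<open>{2 * i, 2 * i + 1}\<close>, each meeting \<open>S\<close> at most once.\<close>

lemma card_indep_path_side:
  assumes S: "S \<subseteq> {2 * r + 2..4 * r + 1}" and ind: "\<forall>u\<in>S. \<forall>v\<in>S. \<not> adj5 u v"
  shows "card S \<le> r"
proof -
  have "inj_on (\<lambda>v. v div 2) S"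
  proof (rule inj_onI)
    fix u v assume uv: "u \<in> S" "v \<in> S" "u div 2 = v div 2"
    then have "u = v \<or> u = Suc v \<or> v = Suc u" by presburger
    then show "u = v" using ind uv by (auto simp: adj5_def)
  qed
  moreover have "(\<lambda>v. v div 2) ` S \<subseteq> {r + 1..2 * r}"
  proof safe
    fix v assume "v \<in> S"
    then have "2 * r + 2 \<le> v" "v \<le> 4 * r + 1" using S by auto
    then show "v div 2 \<in> {r + 1..2 * r}" by auto
  qed
  ultimately show ?thesis using card_inj_on_le[of _ S "{r + 1..2 * r}"] by simp
qed

lemma not_WLP_large:
  assumes n: "n \<ge> 1" "n \<notin> {1, 2, 3, 5, 6, 9}"
  shows "\<not> has_WLP TYPE('k::field_char_0) (5 + n) (tadpole_edges 5 n)"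
proof
  let ?N = "5 + n" and ?E = "tadpole_edges 5 n"
  assume "has_WLP TYPE('k) ?N ?E"
  then obtain l :: "'k mpoly" where l: "l \<in> homog ?N 1"
    and wlp: "\<And>j. j < top_degree TYPE('k) ?N ?E \<Longrightarrow> mult_inj TYPE('k) ?N ?E l j \<or> mult_surj TYPE('k) ?N ?E l j"
    unfolding has_WLP_def by blast
  note E = simple_graph_tadpole5[OF n(1)]
  \<comment> \<open>The largest \<open>r\<close> for which the \<open>r + 1\<close> edges
    \<open>{3 * i - 1, 3 * i}\<close> fit into the vertex set. The bound
    \<open>n + 4 \<le> 4 * r\<close> leaves at most \<open>2 * r\<close> vertices on the path
    side.\<close>
  define r where "r = (n + 2) div 3"
  have "n = 4 \<or> n = 7 \<or> n = 8 \<or> n \<ge> 10" using n by auto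
  then have r: "n + 4 \<le> 4 * r" "r \<ge> 2" "3 * r \<le> n + 2" unfolding r_def by presburger+
  have "\<not> mult_inj TYPE('k) ?N ?E l r"
  proof (rule not_mult_inj_if_split[OF E l])
    show "{1..2 * r + 1} \<union> {2 * r + 2..?N} = {1..?N}" "{1..2 * r + 1} \<inter> {2 * r + 2..?N} = {}"
      using r by auto
    show "card S \<le> r" if "S \<subseteq> {1..2 * r + 1}" "indep ?E S" for S
    proof (rule card_indep_cycle_side[OF that(1) _ r(2)])
      have "S \<subseteq> {1..?N}" using that(1) r by auto
      then show "\<forall>u\<in>S. \<forall>v\<in>S. \<not> adj5 u v" using that(2) indep_tadpole5[OF n(1)] by blast
    qed
    show "card S \<le> r" if "S \<subseteq> {2 * r + 2..?N}" "indep ?E S" for S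
    proof (rule card_indep_path_side)
      show "S \<subseteq> {2 * r + 2..4 * r + 1}" using that(1) r by auto
      have "S \<subseteq> {1..?N}" using that(1) by auto
      then show "\<forall>u\<in>S. \<forall>v\<in>S. \<not> adj5 u v" using that(2) indep_tadpole5[OF n(1)] by blast
    qed
    \<comment> \<open>The vertices 3, 5, ..., \<open>2 * r + 1\<close>; starting at 3 avoids the
      chord.\<close>
    let ?S = "(\<lambda>i. 2 * i + 1) ` {1..r}"
    show S: "?S \<subseteq> {1..2 * r + 1}" by auto
    have "?S \<subseteq> {1..?N}" using r by auto
    moreover have "\<forall>u\<in>?S. \<forall>v\<in>?S. \<not> adj5 u v" unfolding adj5_def by auto presburger+
    ultimately show "indep ?E ?S" using indep_tadpole5[OF n(1)] by blast
    show "card ?S = r" by (subst card_image) (auto simp: inj_on_def)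
  qed
  \<comment> \<open>The pairs \<open>{3 * i - 1, 3 * i}\<close> are separated by the vertices
    congruent to 1 modulo 3, and leaving out 1 removes the chord, so the matching is
    induced.\<close>
  define U where "U = {v \<in> {1..3 * Suc r}. v mod 3 \<noteq> 1}"
  define \<pi> where "\<pi> v = (if v mod 3 = 0 then v - 1 else v + 1)" for v :: nat
  \<comment> \<open>The choice secures \<open>coeffs\<close> of the matching lemma: either the
    partner \<open>3 * i\<close> has a nonzero coefficient, or the chosen \<open>3 * i\<close> has
    coefficient zero.\<close>
  define t where "t i = (if Poly_Mapping.lookup l (Poly_Mapping.single (3 * i) 1) \<noteq> 0
    then 3 * i - 1 else 3 * i)" for i :: nat
  let ?T = "t ` {1..Suc r}"
  have UN: "U \<subseteq> {1..?N}" using r by (auto simp: U_def)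
  have edges: "{u, v} \<in> ?E \<longleftrightarrow> v = \<pi> u" if "u \<in> U" "v \<in> U" for u v
  proof -
    have "{u, v} \<in> ?E \<longleftrightarrow> adj5 u v"
      using that UN tadpole5_edge_iff[OF n(1)] by blast
    also have "\<dots> \<longleftrightarrow> v = \<pi> u"
    proof -
      have uv: "u mod 3 \<noteq> 1" "v mod 3 \<noteq> 1" "u \<ge> 1" "v \<ge> 1" using that by (auto simp: U_def)
      then have "\<not> (u = 1 \<or> v = 1)" by auto
      moreover have "v = Suc u \<longleftrightarrow> v = u + 1 \<and> u mod 3 \<noteq> 0" using uv by (auto simp: mod_Suc split: if_splits)
      moreover have "u = Suc v \<longleftrightarrow> v = u - 1 \<and> u mod 3 = 0" using uv by (auto simp: mod_Suc split: if_splits)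
      ultimately show ?thesis by (auto simp: adj5_def \<pi>_def)
    qed
    finally show ?thesis .
  qed
  have t: "t i = 3 * i - 1 \<or> t i = 3 * i" for i by (simp add: t_def)
  have index_unique: "i = k" if "i \<ge> 1" "k \<ge> 1" "x = 3 * i - 1 \<or> x = 3 * i" "x = 3 * k - 1 \<or> x = 3 * k"
    for i k x :: nat
    using that by presburger
  have \<pi>: "\<pi> (3 * i) = 3 * i - 1" "\<pi> (3 * i - 1) = 3 * i" and
    mem_U: "i \<le> Suc r \<Longrightarrow> 3 * i \<in> U" "i \<le> Suc r \<Longrightarrow> 3 * i - 1 \<in> U" if i: "i \<ge> 1" for i
  proof -
    obtain k where k: "i = Suc k" using i by (cases i) auto
    have "3 * i - 1 = 2 + 3 * k" unfolding k by simp
    then have mod: "(3 * i - 1) mod 3 = 2" by (simp only: mod_mult_self2) simp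
    have "1 \<le> 3 * i - 1" "3 * i - 1 + 1 = 3 * i" using i by linarith+
    then show "\<pi> (3 * i) = 3 * i - 1" "\<pi> (3 * i - 1) = 3 * i" "i \<le> Suc r \<Longrightarrow> 3 * i \<in> U"
      using i unfolding \<pi>_def U_def mod by simp_all
    show "3 * i - 1 \<in> U" if "i \<le> Suc r"
    proof -
      have "3 * i - 1 \<le> 3 * Suc r" using that by arith
      then show ?thesis
        using \<open>1 \<le> 3 * i - 1\<close> mod unfolding U_def mem_Collect_eq atLeastAtMost_iff by simp
    qed
  qed
  have U_cases: "\<exists>i\<ge>1. i \<le> Suc r \<and> (v = 3 * i \<or> v = 3 * i - 1)" if "v \<in> U" for v
  proof -
    have v: "v \<ge> 1" "v \<le> 3 * Suc r" "v mod 3 \<noteq> 1" using that by (auto simp: U_def)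
    define i where "i = (v + 1) div 3"
    have "i \<ge> 1" unfolding i_def using v(1,3) by presburger
    moreover have "i \<le> Suc r" unfolding i_def using v(2) by presburger
    moreover have "v = 3 * i \<or> v = 3 * i - 1" unfolding i_def using v(1,3) by presburger
    ultimately show ?thesis by blast
  qed
  have inj: "inj_on t {1..Suc r}"
    by (rule inj_onI) (metis atLeastAtMost_iff index_unique t)
  have TU: "?T \<subseteq> U"
  proof safe
    fix i assume "i \<in> {1..Suc r}"
    then show "t i \<in> U" using t[of i] mem_U[of i] by auto
  qed
  have Tindep: "indep ?E ?T"
    unfolding indep_def
  proof safe
    fix i k assume ik: "i \<in> {1..Suc r}" "k \<in> {1..Suc r}" "{t i, t k} \<in> ?E"
    then have "t k = \<pi> (t i)" using edges TU by blast
    then have "t k = 3 * i - 1 \<or> t k = 3 * i" using t[of i] \<pi>[of i] ik(1) by auto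
    then have "i = k" using index_unique[of i k "t k"] t[of k] ik(1,2) by simp
    then show False using E ik(3) unfolding simple_graph_def by blast
  qed
  have "\<not> mult_surj TYPE('k) ?N ?E l r"
  proof (rule not_mult_surj_if_matching[OF E l UN _ edges TU Tindep])
    show "\<pi> v \<in> U \<and> \<pi> (\<pi> v) = v" if "v \<in> U" for v
      using U_cases[OF that] \<pi> mem_U by (elim exE conjE disjE) simp_all
    show "card ?T = Suc r" using card_image[OF inj] by simp
    show "\<pi> v \<in> ?T" if v: "v \<in> U" "v \<notin> ?T" for v
    proof -
      obtain i where i: "i \<ge> 1" "i \<le> Suc r" "v = 3 * i \<or> v = 3 * i - 1"
        using U_cases[OF v(1)] by blast
      then have "t i \<in> ?T" by simp
      moreover have "\<pi> v = t i" using v(2) i t[of i] \<pi>[OF i(1)] \<open>t i \<in> ?T\<close> by metis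
      ultimately show ?thesis by simp
    qed
    show "Poly_Mapping.lookup l (Poly_Mapping.single (\<pi> v) 1) \<noteq> 0 \<or>
      Poly_Mapping.lookup l (Poly_Mapping.single v 1) = 0" if v: "v \<in> ?T" for v
    proof -
      obtain i where i: "i \<ge> 1" "v = t i" using v by auto
      show ?thesis
      proof (cases "Poly_Mapping.lookup l (Poly_Mapping.single (3 * i) 1) = 0")
        case True
        then have "v = 3 * i" using i(2) by (simp add: t_def)
        then show ?thesis using True by simp
      next
        case False
        then have "v = 3 * i - 1" using i(2) by (simp add: t_def)
        then have "\<pi> v = 3 * i" using \<pi>(2)[OF i(1)] by simp
        then show ?thesis using False by simp
      qed
    qed
  qed
  \<comment> \<open>\<open>?T\<close> is independent of size \<open>Suc r\<close>, so
    \<open>r\<close> is among the degrees tested by \<open>has_WLP\<close>.\<close>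
  moreover have "Suc r \<le> top_degree TYPE('k) ?N ?E"
    using card_le_top_degree[OF E, of ?T, where 'k = 'k] TU UN Tindep card_image[OF inj] by auto
  ultimately show False
    using wlp[of r] \<open>\<not> mult_inj TYPE('k) ?N ?E l r\<close> by simp
qed

theorem theorem4p4:
  fixes n :: nat
  assumes "n \<ge> 1"
  shows "has_WLP TYPE('k::field_char_0) (5 + n) (tadpole_edges 5 n) \<longleftrightarrow> n \<in> {1, 2, 3, 5, 6, 9}"
  using WLP_small not_WLP_large[OF assms] by blast

end
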